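(* Let $s\ge 1$ be an integer. The capacity region of the $s$-user Multiple Access Adder Channel is the set $$\Bigl\{(R_1,R_2,\ldots,R_s)\in[0,\infty)^s:\ \sum_{i\in A}R_i\le H_{|A|}\bigl(\tfrac12\bigr)\ \text{ for all } A\subseteq\{1,2,\ldots,s\}\Bigr\}.$$
   Context: Notation: for a positive integer $M$, $[M]=\{1,2,\ldots,M\}$. Binomial entropy: for an integer $n\ge 0$ and $p\in[0,1]$, $H_n(p)$ denotes the Shannon entropy (in bits) of the binomial distribution with $n$ independent trials and success probability $p$: $$H_n(p)=-\sum_{k=0}^n\binom nk p^k(1-p)^{n-k}\log_2\Bigl(\binom nk p^k(1-p)^{n-k}\Bigr),$$ with the convention $0\log 0=0$ (so $H_0(p)=0$). The $s$-user Multiple Access Adder Channel has $s$ input alphabets, all equal to $\{0,1\}$, output alphabet $\{0,1,\ldots,s\}$, and is deterministic: when the input symbols are $x_1,\ldots,x_s\in\{0,1\}$, the output symbol is the integer sum $y=x_1+x_2+\cdots+x_s$. Codes: for positive integers $M_1,\ldots,M_s,n$, an $(M_1,\ldots,M_s;n)$ code for this channel consists of encoding functions $e_i:[M_i]\to\{0,1\}^n$, $e_i(m)=(e_i^{(1)}(m),\ldots,e_i^{(n)}(m))$, for $i=1,\ldots,s$, and a decoding function $d:\{0,1,\ldots,s\}^n\to[M_1]\times\cdots\times[M_s]$. When the messages $(m_1,\ldots,m_s)$ are sent, the received word is $Y^n=(y_1,\ldots,y_n)$ with $y_j=\sum_{i=1}^s e_i^{(j)}(m_i)$ for $1\le j\le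 n$. The average probability of error of the code is $$P_e^{(n)}=\frac1{M_1\cdots M_s}\sum_{(m_1,\ldots,m_s)\in[M_1]\times\cdots\times[M_s]}\Pr\bigl(d(Y^n)\ne(m_1,\ldots,m_s)\,\big|\,(m_1,\ldots,m_s)\text{ sent}\bigr)$$ (for this deterministic channel each conditional probability is $0$ or $1$, so $P_e^{(n)}$ is the fraction of message tuples that are decoded incorrectly). Achievability and capacity: a rate tuple $(R_1,\ldots,R_s)$ of nonnegative real numbers is achievable if there is a sequence, indexed by $n=1,2,\ldots$, of $(\lceil 2^{nR_1}\rceil,\ldots,\lceil 2^{nR_s}\rceil;n)$ codes with $P_e^{(n)}\to0$ as $n\to\infty$. The capacity region is the closure (in $\mathbb R^s$) of the set of all achievable rate tuples. *)

theory Defs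
  imports "HOL-Analysis.Analysis"
begin

(* The users are the elements of a finite type 's, so that the number of users is CARD('s) and a
   rate tuple is a vector in real ^ 's.  Words of length n are functions on {1..n} that are
   undefined elsewhere (extensional functions, PiE). *)

(* The convention 0 log 0 = 0 holds because of the leading factor 0. *)
definition binomial_entropy :: "nat \<Rightarrow> real \<Rightarrow> real" where
  "binomial_entropy n p =
     - (\<Sum>k=0..n. (real (n choose k) * p ^ k * (1 - p) ^ (n - k)) *
          log 2 (real (n choose k) * p ^ k * (1 - p) ^ (n - k)))"

definition adder_channel :: "('s::finite \<Rightarrow> nat) \<Rightarrow> nat" where
  "adder_channel x = (\<Sum>i\<in>UNIV. x i)"

definition message_tuples :: "('s::finite \<Rightarrow> nat) \<Rightarrow> ('s \<Rightarrow> nat) set" where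
  "message_tuples M = (\<Pi>\<^sub>E i\<in>UNIV. {1..M i})"

definition is_code ::
  "('s::finite \<Rightarrow> nat) \<Rightarrow> nat \<Rightarrow> ('s \<Rightarrow> nat \<Rightarrow> nat \<Rightarrow> nat) \<Rightarrow> ((nat \<Rightarrow> nat) \<Rightarrow> 's \<Rightarrow> nat) \<Rightarrow> bool" where
  "is_code M n e d \<longleftrightarrow>
     (\<forall>i. e i \<in> {1..M i} \<rightarrow> ({1..n} \<rightarrow>\<^sub>E {0, 1})) \<and>
     d \<in> ({1..n} \<rightarrow>\<^sub>E {0..CARD('s)}) \<rightarrow> message_tuples M"

definition received_word ::
  "nat \<Rightarrow> ('s::finite \<Rightarrow> nat \<Rightarrow> nat \<Rightarrow> nat) \<Rightarrow> ('s \<Rightarrow> nat) \<Rightarrow> nat \<Rightarrow> nat" where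
  "received_word n e m = (\<lambda>j\<in>{1..n}. adder_channel (\<lambda>i. e i (m i) j))"

(* The channel is deterministic, so the conditional probability of a decoding error given that m is
   sent is the 0/1 value of the error event. *)
definition avg_error_prob ::
  "('s::finite \<Rightarrow> nat) \<Rightarrow> nat \<Rightarrow> ('s \<Rightarrow> nat \<Rightarrow> nat \<Rightarrow> nat) \<Rightarrow> ((nat \<Rightarrow> nat) \<Rightarrow> 's \<Rightarrow> nat) \<Rightarrow> real" where
  "avg_error_prob M n e d =
     (1 / real (\<Prod>i\<in>UNIV. M i)) *
     (\<Sum>m\<in>message_tuples M. of_bool (d (received_word n e m) \<noteq> m))"

definition codebook_sizes :: "real ^ 's::finite \<Rightarrow> nat \<Rightarrow> 's \<Rightarrow> nat" where
  "codebook_sizes R n i = nat \<lceil>2 powr (real n * R $ i)\<rceil>"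

definition achievable :: "real ^ 's::finite \<Rightarrow> bool" where
  "achievable R \<longleftrightarrow>
     (\<forall>i. 0 \<le> R $ i) \<and>
     (\<exists>e d. (\<forall>n\<ge>1. is_code (codebook_sizes R n) n (e n) (d n)) \<and>
            (\<lambda>n. avg_error_prob (codebook_sizes R n) n (e n) (d n)) \<longlonglongrightarrow> 0)"

definition capacity_region :: "(real ^ 's::finite) set" where
  "capacity_region = closure {R. achievable R}"

end

theory Submission
  imports Defs "HOL-Computational_Algebra.Polynomial"
begin

text \<open>
  Converse: for fixed \<open>A\<close> let \<open>S\<close> be the word of sums over the users in \<open>A\<close>. Its \<open>j\<close>-th letter is a sum of
  independent Bernoulli variables, whose entropy is at most that of the binomial distribution with
  parameter \<open>1/2\<close>: averaging two success probabilities increases the entropy because the law of the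
  sum is log-concave, and \<open>H\<^sub>n(p)\<close> increases on \<open>[0, 1/2]\<close>. On correctly decoded tuples, \<open>S\<close> and the
  messages outside \<open>A\<close> determine all messages, so comparing \<open>S\<close> with the product of the laws of its
  letters bounds the number of such tuples.

  Achievability: choose all codeword bits uniformly at random. Two tuples that differ exactly on \<open>A\<close>
  collide iff their sums over \<open>A\<close> agree, and these are independent. Gallager's interpolation bounds
  the collision probability by \<open>(\<Prod>i\<in>A. M i) powr \<theta> * (\<Sum>l. b l powr (1 + \<theta>)) ^ n\<close>, \<open>b\<close> the binomial
  law, which decays exponentially for small \<open>\<theta>\<close> if the rates over \<open>A\<close> sum to less than the entropy of \<open>b\<close>.
\<close>

subsection \<open>Pairing a polynomial with a sequence\<close>

text \<open>Laws on the naturals are carried as generating polynomials, so that adding an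
  independent Bernoulli variable multiplies by a linear factor. For such an \<open>F\<close> this is
  an expectation.\<close>

definition coeff_sum :: "real poly \<Rightarrow> (nat \<Rightarrow> real) \<Rightarrow> real" where
  "coeff_sum F g = (\<Sum>k\<le>degree F. coeff F k * g k)"

lemma coeff_sum_eq: "degree F \<le> N \<Longrightarrow> coeff_sum F g = (\<Sum>k\<le>N. coeff F k * g k)"
  unfolding coeff_sum_def by (rule sum.mono_neutral_left) (auto simp: coeff_eq_0)

lemma coeff_sum_add: "coeff_sum (F + G) g = coeff_sum F g + coeff_sum G g"
proof -
  let ?N = "max (degree F) (degree G)"
  show ?thesis
    using degree_add_le_max[of F G]
    by (simp add: coeff_sum_eq[of _ ?N] algebra_simps sum.distrib)
qed

lemma coeff_sum_smult: "coeff_sum (smult c F) g = c * coeff_sum F g"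
  using degree_smult_le[of c F]
  by (simp add: coeff_sum_eq[of _ "degree F"] sum_distrib_left mult.assoc)

lemma coeff_sum_0 [simp]: "coeff_sum 0 g = 0"
  by (simp add: coeff_sum_def)

lemma coeff_sum_sum: "coeff_sum (\<Sum>x\<in>X. F x) g = (\<Sum>x\<in>X. coeff_sum (F x) g)"
  by (induction X rule: infinite_finite_induct) (simp_all add: coeff_sum_add)

lemma coeff_sum_monom: "coeff_sum (monom c k) g = c * g k"
  using degree_monom_le[of c k]
  by (simp add: coeff_sum_eq[of _ k] if_distrib[of "\<lambda>x. x * _"] sum.delta cong: if_cong)

lemma coeff_sum_pCons: "coeff_sum (pCons a F) g = a * g 0 + coeff_sum F (\<lambda>k. g (Suc k))"
proof -
  have "coeff_sum (pCons a F) g = (\<Sum>k\<le>Suc (degree F). coeff (pCons a F) k * g k)"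
    by (intro coeff_sum_eq) (simp add: degree_pCons_le)
  then show ?thesis
    by (simp add: sum.atMost_Suc_shift coeff_sum_def del: sum.atMost_Suc)
qed

lemma coeff_sum_add_fun: "coeff_sum F (\<lambda>k. g k + h k) = coeff_sum F g + coeff_sum F h"
  by (simp add: coeff_sum_def algebra_simps sum.distrib)

lemma coeff_sum_diff_fun: "coeff_sum F (\<lambda>k. g k - h k) = coeff_sum F g - coeff_sum F h"
  by (simp add: coeff_sum_def algebra_simps sum_subtractf)

lemma coeff_sum_cmult_fun: "coeff_sum F (\<lambda>k. c * g k) = c * coeff_sum F g"
  by (simp add: coeff_sum_def sum_distrib_left mult.left_commute)

lemma coeff_sum_one: "coeff_sum F (\<lambda>_. 1) = poly F 1"
  by (simp add: coeff_sum_def poly_altdef)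

lemma coeff_sum_mono:
  assumes "\<And>k. 0 \<le> coeff F k" "\<And>k. 0 < coeff F k \<Longrightarrow> g k \<le> h k"
  shows "coeff_sum F g \<le> coeff_sum F h"
  unfolding coeff_sum_def
  by (intro sum_mono) (metis assms less_eq_real_def mult_left_mono mult_zero_left order_refl)

lemma linear_times: "[:1 - p, p:] * F = smult (1 - p) F + pCons 0 (smult p F)"
  for p :: real by simp

text \<open>Conditions on the value of the extra Bernoulli variable.\<close>

lemma coeff_sum_linear_times:
  "coeff_sum ([:1 - p, p:] * F) g = (1 - p) * coeff_sum F g + p * coeff_sum F (\<lambda>k. g (Suc k))"
  unfolding linear_times by (simp add: coeff_sum_add coeff_sum_smult coeff_sum_pCons)

subsection \<open>The entropy of a binomial distribution\<close>

definition binomial_mean :: "nat \<Rightarrow> (nat \<Rightarrow> real) \<Rightarrow> real \<Rightarrow> real" where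
  "binomial_mean n g p = coeff_sum ([:1 - p, p:] ^ n) g"

lemma degree_linear_power_le: "degree ([:a, b:] ^ n) \<le> n" for a b :: real
  using degree_power_le[of "[:a, b:]" n] by (auto split: if_splits)

lemma binomial_mean_altdef:
  "binomial_mean n g p = (\<Sum>k\<le>n. Bernstein n k p * g k)"
  unfolding binomial_mean_def coeff_sum_eq[OF degree_linear_power_le]
  by (intro sum.cong) (simp_all add: coeff_linear_poly_power Bernstein_def)

lemma binomial_mean_0 [simp]: "binomial_mean 0 g p = g 0"
  by (simp add: binomial_mean_altdef Bernstein_def)

lemma binomial_mean_Suc:
  "binomial_mean (Suc n) g p = (1 - p) * binomial_mean n g p + p * binomial_mean n (\<lambda>k. g (Suc k)) p"
  by (simp only: binomial_mean_def power_Suc coeff_sum_linear_times)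

text \<open>Induction by conditioning on one trial: differentiating the weights \<open>1 - p\<close>
  and \<open>p\<close> gives one mean of the forward difference, and the two inner derivatives
  recombine by the recursion into \<open>n\<close> more.\<close>

lemma DERIV_binomial_mean:
  "(binomial_mean n g has_real_derivative
     real n * binomial_mean (n - 1) (\<lambda>k. g (Suc k) - g k) p) (at p)"
proof (induction n arbitrary: g)
  case 0
  have "binomial_mean 0 g = (\<lambda>_. g 0)" by auto
  then show ?case by simp
next
  case (Suc n)
  have eq: "binomial_mean (Suc n) g =
      (\<lambda>p. (1 - p) * binomial_mean n g p + p * binomial_mean n (\<lambda>k. g (Suc k)) p)"
    by (auto simp: binomial_mean_Suc)
  let ?D = "\<lambda>g k. g (Suc k) - g k :: real"
  \<comment> \<open>The factor \<open>real n\<close> makes this true at \<open>n = 0\<close>, where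
    truncated subtraction gives \<open>n - 1 = 0\<close>.\<close>
  have rec: "real n * binomial_mean n (?D g) p =
     real n * ((1 - p) * binomial_mean (n - 1) (?D g) p
       + p * binomial_mean (n - 1) (\<lambda>k. ?D g (Suc k)) p)"
    by (cases n) (auto simp: binomial_mean_Suc)
  have diff: "binomial_mean n (?D g) p
      = binomial_mean n (\<lambda>k. g (Suc k)) p - binomial_mean n g p"
    unfolding binomial_mean_def by (rule coeff_sum_diff_fun)
  show ?case
    unfolding eq
    by (rule derivative_eq_intros Suc.IH refl)+ (insert rec diff, simp only: of_nat_Suc diff_Suc_1, algebra)
qed

lemma Bernstein_reflect: "k \<le> n \<Longrightarrow> Bernstein n k (1 - p) = Bernstein n (n - k) p"
  by (simp add: Bernstein_def binomial_symmetric[symmetric])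

lemma binomial_mean_reflect:
  "binomial_mean n (\<lambda>k. g (n - k)) p = binomial_mean n g (1 - p)"
proof -
  have "binomial_mean n (\<lambda>k. g (n - k)) p = (\<Sum>k\<le>n. Bernstein n (n - k) p * g k)"
    unfolding binomial_mean_altdef by (rule sum.reindex_bij_witness[of _ "\<lambda>k. n - k" "\<lambda>k. n - k"]) auto
  also have "\<dots> = binomial_mean n g (1 - p)"
    unfolding binomial_mean_altdef
    by (intro sum.cong) (simp_all add: Bernstein_reflect)
  finally show ?thesis .
qed

text \<open>After multiplication by \<open>p\<close>, absorption turns each term at \<open>k\<close>
  into the weight at \<open>k + 1\<close> of the \<open>n\<close>-trial law. These weights sum to at
  most 1, only the one at 0 being absent.\<close>

lemma binomial_mean_inverse_Suc:
  assumes "0 < p" "p \<le> 1"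
  shows "real n * binomial_mean (n - 1) (\<lambda>k. 1 / real (Suc k)) p \<le> 1 / p"
proof (cases n)
  case (Suc m)
  have "p * (real n * binomial_mean (n - 1) (\<lambda>k. 1 / real (Suc k)) p)
      = (\<Sum>k\<le>m. Bernstein n (Suc k) p)"
    unfolding binomial_mean_altdef sum_distrib_left Suc diff_Suc_1
  proof (intro sum.cong refl)
    fix k assume "k \<in> {..m}"
    have "real (Suc m) * real (m choose k) = real (Suc k) * real (Suc m choose Suc k)"
      using Suc_times_binomial_eq[of m k] by (metis mult.commute of_nat_mult)
    then have b: "real (Suc m) * real (m choose k) / real (Suc k) = real (Suc m choose Suc k)"
      by (simp add: field_simps del: binomial_Suc_Suc of_nat_Suc)
    have "p * (real (Suc m) * (Bernstein m k p * (1 / real (Suc k)))) =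
       (real (Suc m) * real (m choose k) / real (Suc k)) * p ^ Suc k * (1 - p) ^ (Suc m - Suc k)"
      unfolding Bernstein_def by simp
    then show "p * (real (Suc m) * (Bernstein m k p * (1 / real (Suc k)))) = Bernstein (Suc m) (Suc k) p"
      unfolding b Bernstein_def .
  qed
  also have "\<dots> \<le> (\<Sum>k\<le>n. Bernstein n k p)"
    using assms Bernstein_nonneg[of p n 0] by (simp add: Suc sum.atMost_Suc_shift[of _ m] del: sum.atMost_Suc sum_Bernstein)
  also have "\<dots> = 1" by simp
  finally show ?thesis using assms by (simp add: field_simps)
qed (use assms in auto)

lemma binomial_mean_mono:
  assumes "0 \<le> p" "p \<le> 1" "\<And>k. k \<le> n \<Longrightarrow> g k \<le> h k"
  shows "binomial_mean n g p \<le> binomial_mean n h p"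
  unfolding binomial_mean_altdef
  by (intro sum_mono mult_left_mono) (use assms in \<open>auto simp: Bernstein_nonneg\<close>)

text \<open>The derivative is \<open>n\<close> times the mean of \<open>ln (1 + 1 / (k + 1))\<close>
  over \<open>n - 1\<close> trials, minus \<open>1 / x\<close>; with
  \<open>ln (1 + u) \<le> u\<close> the preceding bound makes it nonpositive.\<close>

lemma binomial_mean_ln_Suc_decreasing:
  assumes "0 < p" "p \<le> q" "q \<le> 1"
  shows "binomial_mean n (\<lambda>k. ln (real (Suc k))) q - ln q
    \<le> binomial_mean n (\<lambda>k. ln (real (Suc k))) p - ln p"
proof (rule DERIV_nonpos_imp_nonincreasing[OF \<open>p \<le> q\<close>], goal_cases)
  case (1 x)
  let ?g = "\<lambda>k. ln (real (Suc k))"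
  have x: "0 < x" "x \<le> 1" using 1 assms by auto
  have "real n * binomial_mean (n - 1) (\<lambda>k. ?g (Suc k) - ?g k) x
      \<le> real n * binomial_mean (n - 1) (\<lambda>k. 1 / real (Suc k)) x"
  proof (intro mult_left_mono binomial_mean_mono)
    fix k
    have "?g (Suc k) - ?g k = ln (real (Suc (Suc k)) / real (Suc k))"
      by (simp add: ln_div)
    also have "real (Suc (Suc k)) / real (Suc k) = 1 + 1 / real (Suc k)"
      by (simp add: field_simps)
    finally have "?g (Suc k) - ?g k = ln (1 + 1 / real (Suc k))" .
    also have "\<dots> \<le> 1 / real (Suc k)" by (rule ln_add_one_self_le_self) simp
    finally show "?g (Suc k) - ?g k \<le> 1 / real (Suc k)" .
  qed (use x in auto)
  also have "\<dots> \<le> 1 / x" by (rule binomial_mean_inverse_Suc[OF x])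
  finally have "real n * binomial_mean (n - 1) (\<lambda>k. ?g (Suc k) - ?g k) x - 1 / x \<le> 0" by simp
  moreover have "((\<lambda>x. binomial_mean n ?g x - ln x) has_real_derivative
       real n * binomial_mean (n - 1) (\<lambda>k. ?g (Suc k) - ?g k) x - 1 / x) (at x)"
    by (rule derivative_intros DERIV_binomial_mean DERIV_ln_divide x)+
  ultimately show ?case by blast
qed

section \<open>Dependence of the binomial entropy on the success probability\<close>

definition binomial_entropy_nats :: "nat \<Rightarrow> real \<Rightarrow> real" where
  "binomial_entropy_nats n p = - (\<Sum>k\<le>n. Bernstein n k p * ln (Bernstein n k p))"

lemma binomial_entropy_conv_nats:
  "binomial_entropy n p = binomial_entropy_nats n p / ln 2"
  by (simp add: binomial_entropy_def binomial_entropy_nats_def Bernstein_def log_def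
      atMost_atLeast0 sum_divide_distrib)

lemma binomial_entropy_nats_reflect: "binomial_entropy_nats n (1 - p) = binomial_entropy_nats n p"
  unfolding binomial_entropy_nats_def
  by (intro arg_cong[where f = uminus] sum.reindex_bij_witness[of _ "\<lambda>k. n - k" "\<lambda>k. n - k"])
    (auto simp: Bernstein_reflect)

text \<open>The logarithm of a weight splits into \<open>ln (n choose k)\<close> and a part affine
  in \<open>k\<close>, for which only the mean \<open>n * p\<close> of the law matters.\<close>

lemma binomial_entropy_nats_eq:
  assumes "0 < p" "p < 1"
  shows "binomial_entropy_nats n p =
    - (real n * (p * ln p + (1 - p) * ln (1 - p))) - binomial_mean n (\<lambda>k. ln (real (n choose k))) p"
proof -
  have "(\<Sum>k\<le>n. Bernstein n k p * ln (Bernstein n k p)) =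
     (\<Sum>k\<le>n. Bernstein n k p * ln (real (n choose k)) + (ln p - ln (1 - p)) * (real k * Bernstein n k p)
        + (real n * ln (1 - p)) * Bernstein n k p)"
  proof (intro sum.cong refl)
    fix k assume k: "k \<in> {..n}"
    then have h: "ln (Bernstein n k p) = ln (real (n choose k)) + real k * ln p + real (n - k) * ln (1 - p)"
      unfolding Bernstein_def using assms by (subst ln_mult ln_realpow | simp)+
    show "Bernstein n k p * ln (Bernstein n k p) =
      Bernstein n k p * ln (real (n choose k)) + (ln p - ln (1 - p)) * (real k * Bernstein n k p)
        + (real n * ln (1 - p)) * Bernstein n k p"
      unfolding h using k by (simp add: of_nat_diff algebra_simps)
  qed
  also have "\<dots> = binomial_mean n (\<lambda>k. ln (real (n choose k))) p + (ln p - ln (1 - p)) * (real n * p)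
      + real n * ln (1 - p)"
    by (simp add: binomial_mean_altdef sum.distrib sum_distrib_left[symmetric])
  finally show ?thesis
    by (simp add: binomial_entropy_nats_def algebra_simps)
qed

text \<open>Write G for the function shown decreasing in
  \<open>binomial_mean_ln_Suc_decreasing\<close>, with \<open>N = n - 1\<close> trials. The
  derivative at \<open>x\<close> is \<open>n\<close> times the difference of G at \<open>x\<close>
  and at \<open>1 - x\<close>, nonnegative since \<open>x \<le> 1 - x\<close>.\<close>

lemma binomial_entropy_nats_incr:
  assumes "0 < p" "p \<le> 1/2"
  shows "binomial_entropy_nats n p \<le> binomial_entropy_nats n (1/2)"
proof (cases n)
  case 0
  then show ?thesis by (simp add: binomial_entropy_nats_def Bernstein_def)
next
  case (Suc N)
  let ?c = "\<lambda>k. ln (real (n choose k))" and ?g = "\<lambda>k. ln (real (Suc k))"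
  define f where "f x = - (real n * (x * ln x + (1 - x) * ln (1 - x))) - binomial_mean n ?c x" for x
  have "f p \<le> f (1/2)"
  proof (rule DERIV_nonneg_imp_nondecreasing[OF \<open>p \<le> 1/2\<close>], goal_cases)
    case (1 x)
    have x: "0 < x" "x \<le> 1/2" using 1 assms by auto
    \<comment> \<open>Neighbouring binomial coefficients have ratio
      \<open>(N - k + 1) / (k + 1)\<close>; reflecting the law turns the mean of the numerator's
      logarithm into a mean at \<open>1 - x\<close>.\<close>
    have "binomial_mean N (\<lambda>k. ?c (Suc k) - ?c k) x = binomial_mean N (\<lambda>k. ?g (N - k) - ?g k) x"
      unfolding binomial_mean_altdef
    proof (intro sum.cong refl arg_cong[where f = "\<lambda>x. _ * x"])
      fix k assume "k \<in> {..N}"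
      then have k: "k \<le> N" by simp
      have "Suc k * (n choose Suc k) = Suc (N - k) * (n choose k)"
        using binomial_absorb_comp[of n k] Suc_times_binomial_eq[of N k] k unfolding Suc
        by (simp add: Suc_diff_le mult.commute)
      then have "real (Suc k) * real (n choose Suc k) = real (Suc (N - k)) * real (n choose k)"
        by (metis of_nat_mult)
      then have "ln (real (Suc k) * real (n choose Suc k)) = ln (real (Suc (N - k)) * real (n choose k))"
        by simp
      moreover have "0 < n choose k" "0 < n choose Suc k" using k Suc by (auto simp: zero_less_binomial_iff simp del: binomial_Suc_Suc)
      ultimately show "?c (Suc k) - ?c k = ?g (N - k) - ?g k"
        by (subst (asm) (1 2) ln_mult) auto
    qed
    also have "\<dots> = binomial_mean N ?g (1 - x) - binomial_mean N ?g x"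
      using binomial_mean_reflect[of N ?g x] unfolding binomial_mean_def
      by (simp only: coeff_sum_diff_fun)
    finally have eq: "binomial_mean N (\<lambda>k. ?c (Suc k) - ?c k) x
       = binomial_mean N ?g (1 - x) - binomial_mean N ?g x" .
    have "(f has_real_derivative
         - (real n * (1 * ln x + 1 / x * x + ((0 - 1) * ln (1 - x) + 1 / (1 - x) * (0 - 1) * (1 - x))))
         - real n * binomial_mean N (\<lambda>k. ?c (Suc k) - ?c k) x) (at x)"
      unfolding f_def using x DERIV_binomial_mean[of n ?c x] Suc
      by (auto intro!: derivative_eq_intros)
    also have "- (real n * (1 * ln x + 1 / x * x + ((0 - 1) * ln (1 - x) + 1 / (1 - x) * (0 - 1) * (1 - x))))
         - real n * binomial_mean N (\<lambda>k. ?c (Suc k) - ?c k) x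
       = real n * ((binomial_mean N ?g x - ln x) - (binomial_mean N ?g (1 - x) - ln (1 - x)))"
      unfolding eq using x by (simp add: algebra_simps)
    finally show ?case
      using binomial_mean_ln_Suc_decreasing[of x "1 - x" N] x
      by (intro exI conjI) (assumption, auto intro!: mult_nonneg_nonneg)
  qed
  then show ?thesis
    unfolding f_def using assms by (simp add: binomial_entropy_nats_eq)
qed

lemma Bernstein_ln_nonpos:
  assumes "0 \<le> p" "p \<le> 1" "k \<le> n"
  shows "Bernstein n k p * ln (Bernstein n k p) \<le> 0"
proof -
  have "Bernstein n k p \<le> (\<Sum>k\<le>n. Bernstein n k p)"
    using assms by (intro member_le_sum) (auto simp: Bernstein_nonneg)
  then have "Bernstein n k p \<le> 1" by simp
  then show ?thesis using Bernstein_nonneg[OF assms(1,2), of n k]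
    by (cases "Bernstein n k p = 0") (auto simp: mult_nonneg_nonpos)
qed

lemma binomial_entropy_nats_nonneg:
  assumes "0 \<le> p" "p \<le> 1"
  shows "0 \<le> binomial_entropy_nats n p"
  unfolding binomial_entropy_nats_def using Bernstein_ln_nonpos[OF assms] by (auto intro!: sum_nonpos)

text \<open>Reflection reduces to \<open>p \<le> 1/2\<close>; the endpoint 0, outside the reach of
  the derivative argument, has entropy 0.\<close>

lemma binomial_entropy_nats_le_half:
  assumes "0 \<le> p" "p \<le> 1"
  shows "binomial_entropy_nats n p \<le> binomial_entropy_nats n (1/2)"
proof -
  have *: "binomial_entropy_nats n p \<le> binomial_entropy_nats n (1/2)" if "0 \<le> p" "p \<le> 1/2" for p
  proof (cases "p = 0")
    case True
    have "(\<Sum>k\<le>n. Bernstein n k 0 * ln (Bernstein n k 0)) = 0"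
      by (intro sum.neutral) (auto simp: Bernstein_def power_0_left)
    then show ?thesis
      using True binomial_entropy_nats_nonneg[of "1/2" n] by (simp add: binomial_entropy_nats_def)
  qed (use that binomial_entropy_nats_incr in auto)
  show ?thesis
    using *[of p] *[of "1 - p"] assms binomial_entropy_nats_reflect[of n p] by (cases "p \<le> 1/2") auto
qed

declare mult_pCons_left [simp del]

subsection \<open>The entropy of a sum of independent Bernoulli variables\<close>

text \<open>Generating polynomial of a sum of independent Bernoulli variables with parameters
  \<open>p i\<close>.\<close>

definition poisson_binomial :: "'a set \<Rightarrow> ('a \<Rightarrow> real) \<Rightarrow> real poly" where
  "poisson_binomial A p = (\<Prod>i\<in>A. [:1 - p i, p i:])"

definition coeff_entropy :: "real poly \<Rightarrow> real" where
  "coeff_entropy F = - coeff_sum F (\<lambda>k. ln (coeff F k))"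

text \<open>For \<open>i < j\<close> the inequality also rules out internal zeros, which plain log-concavity does not.\<close>
definition log_concave_seq :: "(nat \<Rightarrow> real) \<Rightarrow> bool" where
  "log_concave_seq a \<longleftrightarrow> (\<forall>k. 0 \<le> a k) \<and> (\<forall>i j. i \<le> j \<longrightarrow> a i * a (j + 2) \<le> a (i + 1) * a (j + 1))"

text \<open>Expanding leaves squares, controlled by log-concavity of \<open>F\<close> and of its
  shift \<open>b\<close>, and two mixed terms. One occurs on both sides because
  \<open>b (j + 2) = a (j + 1)\<close> and \<open>b (i + 1) = a i\<close>; the other is
  \<open>ba\<close>.\<close>

lemma log_concave_seq_linear_times:
  assumes F: "log_concave_seq (coeff F)" and p: "0 \<le> p" "p \<le> 1"
  shows "log_concave_seq (coeff ([:1 - p, p:] * F))"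
proof -
  define a where "a = coeff F"
  define b where "b k = (case k of 0 \<Rightarrow> 0 | Suc k \<Rightarrow> a k)" for k
  have b_Suc: "b (Suc k) = a k" for k by (simp add: b_def)
  have c: "coeff ([:1 - p, p:] * F) = (\<lambda>k. (1 - p) * a k + p * b k)"
    unfolding linear_times by (auto simp: a_def b_def coeff_pCons split: nat.splits)
  have a0: "0 \<le> a k" and b0: "0 \<le> b k" for k
    using F by (auto simp: log_concave_seq_def a_def b_def split: nat.splits)
  have aa: "a i * a (j + 2) \<le> a (i + 1) * a (j + 1)" if "i \<le> j" for i j
    using F that by (auto simp: log_concave_seq_def a_def)
  have bb: "b i * b (j + 2) \<le> b (i + 1) * b (j + 1)" if "i \<le> j" for i j
    using that aa[of "i - 1" "j - 1"] a0 by (cases i; cases j) (auto simp: b_def)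
  \<comment> \<open>For \<open>i = k + 1\<close>, log-concavity is used twice, each time moving the
    indices \<open>k\<close> and \<open>j + 2\<close> inward by one; for \<open>i = j\<close> the
    second move only swaps the factors.\<close>
  have ba: "b i * a (j + 2) \<le> a (i + 1) * b (j + 1)" if "i \<le> j" for i j
  proof (cases i)
    case (Suc k)
    have "a k * a (j + 2) \<le> a (k + 1) * a (j + 1)" by (rule aa) (use Suc that in auto)
    also have "a (k + 1) * a (j + 1) \<le> a (k + 2) * a j"
    proof (cases "i = j")
      case False
      then have "k + 1 \<le> j - 1" using Suc that by auto
      from aa[OF this] show ?thesis using False that Suc by (simp add: Suc_diff_Suc numeral_2_eq_2)
    qed (use Suc in \<open>simp add: mult.commute\<close>)
    finally show ?thesis using Suc by (simp add: b_def numeral_2_eq_2)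
  qed (use a0 b0 in \<open>auto simp: b_def\<close>)
  show ?thesis
    unfolding log_concave_seq_def c
  proof (intro conjI allI impI)
    fix k show "0 \<le> (1 - p) * a k + p * b k" using a0 b0 p by auto
  next
    fix i j :: nat assume ij: "i \<le> j"
    have "((1 - p) * a i + p * b i) * ((1 - p) * a (j + 2) + p * b (j + 2)) =
      (1 - p)^2 * (a i * a (j + 2)) + p^2 * (b i * b (j + 2))
        + (1 - p) * p * (b i * a (j + 2)) + (1 - p) * p * (b (i + 1) * a (j + 1))"
      by (simp add: b_Suc numeral_2_eq_2 algebra_simps power2_eq_square)
    also have "\<dots> \<le> (1 - p)^2 * (a (i + 1) * a (j + 1)) + p^2 * (b (i + 1) * b (j + 1))
        + (1 - p) * p * (a (i + 1) * b (j + 1)) + (1 - p) * p * (b (i + 1) * a (j + 1))"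
      by (intro add_mono mult_left_mono aa bb ba ij order_refl) (use p in auto)
    also have "\<dots> = ((1 - p) * a (i + 1) + p * b (i + 1)) * ((1 - p) * a (j + 1) + p * b (j + 1))"
      by (simp add: algebra_simps power2_eq_square)
    finally show "((1 - p) * a i + p * b i) * ((1 - p) * a (j + 2) + p * b (j + 2))
      \<le> ((1 - p) * a (i + 1) + p * b (i + 1)) * ((1 - p) * a (j + 1) + p * b (j + 1))" .
  qed
qed

lemma log_concave_poisson_binomial:
  assumes "finite A" "\<And>i. i \<in> A \<Longrightarrow> 0 \<le> p i \<and> p i \<le> 1"
  shows "log_concave_seq (coeff (poisson_binomial A p))"
  using assms
proof (induction A)
  case empty
  then show ?case by (auto simp: poisson_binomial_def log_concave_seq_def)
next
  case (insert x A)
  then show ?case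
    unfolding poisson_binomial_def by (subst prod.insert) (auto intro!: log_concave_seq_linear_times)
qed

lemma poly_poisson_binomial_1 [simp]: "poly (poisson_binomial A p) 1 = 1"
  by (simp add: poisson_binomial_def poly_prod)

lemma degree_poisson_binomial_le: "finite A \<Longrightarrow> degree (poisson_binomial A p) \<le> card A"
proof -
  assume A: "finite A"
  have "degree (poisson_binomial A p) \<le> (\<Sum>i\<in>A. degree [:1 - p i, p i:])"
    unfolding poisson_binomial_def using degree_prod_sum_le[OF A, of "\<lambda>i. [:1 - p i, p i:]"] by (simp add: o_def)
  also have "\<dots> \<le> (\<Sum>i\<in>A. 1)" by (intro sum_mono) auto
  finally show ?thesis by simp
qed

lemma poisson_binomial_const:
  "finite A \<Longrightarrow> poisson_binomial A (\<lambda>_. p) = [:1 - p, p:] ^ card A"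
  by (simp add: poisson_binomial_def)

lemma coeff_entropy_binomial: "coeff_entropy ([:1 - p, p:] ^ n) = binomial_entropy_nats n p"
  unfolding coeff_entropy_def coeff_sum_eq[OF degree_linear_power_le] binomial_entropy_nats_def
  by (intro arg_cong[where f = uminus] sum.cong) (simp_all add: coeff_linear_poly_power Bernstein_def)

text \<open>Nonnegativity of relative entropy, from \<open>ln u \<le> u - 1\<close> term by term.
  The support condition excludes terms where \<open>ln 0 = 0\<close> would stand for minus
  infinity.\<close>

lemma gibbs_coeff_sum:
  assumes P: "\<And>k. 0 \<le> coeff P k" and Q: "\<And>k. 0 \<le> coeff Q k"
    and supp: "\<And>k. 0 < coeff P k \<Longrightarrow> 0 < coeff Q k" and mass: "poly P 1 = poly Q 1"
  shows "coeff_entropy P \<le> - coeff_sum P (\<lambda>k. ln (coeff Q k))"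
proof -
  let ?N = "max (degree P) (degree Q)"
  have "coeff P k * ln (coeff Q k) - coeff P k * ln (coeff P k) \<le> coeff Q k - coeff P k" for k
  proof (cases "coeff P k = 0")
    case False
    then have pos: "0 < coeff P k" "0 < coeff Q k" using P[of k] supp[of k] by auto
    then have "ln (coeff Q k) - ln (coeff P k) \<le> coeff Q k / coeff P k - 1"
      using ln_le_minus_one[of "coeff Q k / coeff P k"] by (simp add: ln_div)
    then have "coeff P k * (ln (coeff Q k) - ln (coeff P k)) \<le> coeff P k * (coeff Q k / coeff P k - 1)"
      using pos by (intro mult_left_mono) auto
    then show ?thesis using pos by (simp add: algebra_simps)
  qed (use Q in auto)
  then have "(\<Sum>k\<le>?N. coeff P k * ln (coeff Q k) - coeff P k * ln (coeff P k)) \<le>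
     (\<Sum>k\<le>?N. coeff Q k * 1 - coeff P k * 1)"
    by (intro sum_mono) simp
  also have "\<dots> = coeff_sum Q (\<lambda>_. 1) - coeff_sum P (\<lambda>_. 1)"
    by (simp only: sum_subtractf coeff_sum_eq[of _ ?N] max.cobounded1 max.cobounded2)
  also have "\<dots> = 0" by (simp only: coeff_sum_one mass diff_self)
  finally show ?thesis
    by (simp add: coeff_entropy_def coeff_sum_eq[of _ ?N] sum_subtractf)
qed

text \<open>With \<open>x + y\<close> fixed, the law of the sum is affine in \<open>x y\<close> with slope the second difference
  of \<open>F\<close>. Summing by parts against the logarithm of the new law, which is concave, gives the sign.\<close>
lemma coeff_entropy_averaging:
  assumes F: "log_concave_seq (coeff F)" "poly F 1 = 1"
    and x: "0 \<le> x" "x \<le> 1" "0 \<le> y" "y \<le> 1" and x': "0 < x'" "x' < 1" "0 < y'" "y' < 1"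
    and sum: "x' + y' = x + y" and prod: "x * y \<le> x' * y'"
  shows "coeff_entropy ([:1 - x, x:] * ([:1 - y, y:] * F)) \<le>
    coeff_entropy ([:1 - x', x':] * ([:1 - y', y':] * F))"
proof -
  define P where "P = [:1 - x, x:] * ([:1 - y, y:] * F)"
  define Q where "Q = [:1 - x', x':] * ([:1 - y', y':] * F)"
  define t where "t = x' * y' - x * y"
  have lcP: "log_concave_seq (coeff P)" and lcQ: "log_concave_seq (coeff Q)"
    unfolding P_def Q_def using x x' by (auto intro!: log_concave_seq_linear_times F)
  have F0: "0 \<le> coeff F k" for k using F by (auto simp: log_concave_seq_def)
  have Q0: "0 \<le> coeff Q k" for k using lcQ by (auto simp: log_concave_seq_def)
  have P0: "0 \<le> coeff P k" for k using lcP by (auto simp: log_concave_seq_def)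
  have coeff2: "coeff ([:1 - u, u:] * ([:1 - v, v:] * F)) k =
     (1 - u) * (1 - v) * coeff F k + (u * (1 - v) + v * (1 - u)) * coeff (pCons 0 F) k
       + u * v * coeff (pCons 0 (pCons 0 F)) k" for u v k
    unfolding linear_times by (auto simp: coeff_pCons algebra_simps split: nat.splits)
  have pc0: "0 \<le> coeff (pCons 0 F) k" "0 \<le> coeff (pCons 0 (pCons 0 F)) k" for k
    using F0 by (auto simp: coeff_pCons split: nat.splits)
  \<comment> \<open>As \<open>x'\<close> and \<open>y'\<close> lie strictly inside the unit
    interval, \<open>Q\<close> is positive on the support of \<open>F\<close> and on its shifts by
    one and two, so the logarithms below are genuine.\<close>
  have Q_pos: "0 < coeff Q k"
    if "0 < coeff F k \<or> 0 < coeff (pCons 0 F) k \<or> 0 < coeff (pCons 0 (pCons 0 F)) k" for k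
  proof -
    have "0 < (1 - x') * (1 - y')" "0 < x' * (1 - y') + y' * (1 - x')" "0 < x' * y'"
      using x' by (auto intro!: add_pos_pos)
    then show ?thesis
      unfolding Q_def coeff2 using that F0[of k] pc0[of k]
      by (smt (verit) mult_nonneg_nonneg mult_pos_pos)
  qed
  have "coeff_entropy P \<le> - coeff_sum P (\<lambda>k. ln (coeff Q k))"
  proof (rule gibbs_coeff_sum[OF P0 Q0])
    fix k assume "0 < coeff P k"
    then have "0 < coeff F k \<or> 0 < coeff (pCons 0 F) k \<or> 0 < coeff (pCons 0 (pCons 0 F)) k"
      unfolding P_def coeff2 using F0[of k] pc0[of k] by (smt (verit) mult_eq_0_iff)
    then show "0 < coeff Q k" by (rule Q_pos)
  qed (use F in \<open>simp add: P_def Q_def\<close>)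
  \<comment> \<open>With \<open>x' + y' = x + y\<close>, raising the product by \<open>t\<close>
    changes the weights of the shifts by 0, 1 and 2 by \<open>t\<close>, \<open>- 2 * t\<close> and
    \<open>t\<close>.\<close>
  also have "Q = P + smult t (F + smult (-2) (pCons 0 F) + pCons 0 (pCons 0 F))"
  proof (rule poly_eqI)
    fix k
    have "y' = x + y - x'" using sum by simp
    then show "coeff Q k = coeff (P + smult t (F + smult (-2) (pCons 0 F) + pCons 0 (pCons 0 F))) k"
      unfolding P_def Q_def coeff_add coeff_smult coeff2 t_def by (simp add: algebra_simps)
  qed
  then have "coeff_sum Q g = coeff_sum P g +
      t * coeff_sum F (\<lambda>k. g k + (g (Suc (Suc k)) - 2 * g (Suc k)))" for g
    by (simp only: coeff_sum_add coeff_sum_smult coeff_sum_pCons coeff_sum_add_fun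
        coeff_sum_diff_fun coeff_sum_cmult_fun) simp
  then have "- coeff_sum P (\<lambda>k. ln (coeff Q k)) = coeff_entropy Q + t * coeff_sum F (\<lambda>k.
     ln (coeff Q k) + (ln (coeff Q (Suc (Suc k))) - 2 * ln (coeff Q (Suc k))))"
    by (simp add: coeff_entropy_def)
  also have "\<dots> \<le> coeff_entropy Q + t * coeff_sum F (\<lambda>k. 0)"
  proof (intro add_left_mono mult_left_mono coeff_sum_mono)
    fix k assume "0 < coeff F k"
    then have pos: "0 < coeff Q k" "0 < coeff Q (Suc k)" "0 < coeff Q (Suc (Suc k))"
      by (auto intro: Q_pos)
    have "coeff Q k * coeff Q (Suc (Suc k)) \<le> coeff Q (Suc k) * coeff Q (Suc k)"
      using lcQ by (auto simp: log_concave_seq_def numeral_2_eq_2)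
    then have "ln (coeff Q k * coeff Q (Suc (Suc k))) \<le> ln (coeff Q (Suc k) * coeff Q (Suc k))"
      using pos by (subst ln_le_cancel_iff) auto
    then show "ln (coeff Q k) + (ln (coeff Q (Suc (Suc k))) - 2 * ln (coeff Q (Suc k))) \<le> 0"
      using pos by (simp add: ln_mult)
  qed (use F0 prod in \<open>auto simp: t_def\<close>)
  finally show ?thesis by (simp add: P_def Q_def coeff_sum_def)
qed

text \<open>Induction on the number of parameters away from the mean. One below and one above it
  become \<open>\<mu>\<close> and the value that keeps the sum; moving the pair closer together
  raises its product, so the averaging lemma applies.\<close>

lemma coeff_entropy_poisson_binomial_le_mean:
  fixes p :: "'a \<Rightarrow> real" and \<mu> :: real
  assumes A: "finite A" "\<And>i. i \<in> A \<Longrightarrow> 0 \<le> p i \<and> p i \<le> 1" and mean: "(\<Sum>i\<in>A. p i) = card A * \<mu>"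
  shows "coeff_entropy (poisson_binomial A p) \<le> coeff_entropy (poisson_binomial A (\<lambda>_. \<mu>))"
  using A(2) mean
proof (induction "card {i\<in>A. p i \<noteq> \<mu>}" arbitrary: p rule: less_induct)
  case less
  show ?case
  proof (cases "\<forall>i\<in>A. p i = \<mu>")
    case True
    then show ?thesis by (simp add: poisson_binomial_def)
  next
    case False
    have lt: "\<exists>i\<in>A. p i < \<mu>"
    proof (rule ccontr)
      assume "\<not> ?thesis"
      then have "\<And>i. i \<in> A \<Longrightarrow> \<mu> \<le> p i" by force
      then have "(\<Sum>i\<in>A. \<mu>) < (\<Sum>i\<in>A. p i)" using False A(1) by (intro sum_strict_mono_ex1) force+
      then show False using less.prems by simp
    qed
    have gt: "\<exists>i\<in>A. \<mu> < p i"
    proof (rule ccontr)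
      assume "\<not> ?thesis"
      then have "\<And>i. i \<in> A \<Longrightarrow> p i \<le> \<mu>" by force
      then have "(\<Sum>i\<in>A. p i) < (\<Sum>i\<in>A. \<mu>)" using False A(1) by (intro sum_strict_mono_ex1) force+
      then show False using less.prems by simp
    qed
    from lt gt obtain i j where ij: "i \<in> A" "j \<in> A" "p i < \<mu>" "\<mu> < p j" by blast
    then have neq: "i \<noteq> j" by auto
    define p' where "p' = p(i := \<mu>, j := p i + p j - \<mu>)"
    have p'ij: "p' i = \<mu>" "p' j = p i + p j - \<mu>" using neq by (auto simp: p'_def)
    have range: "0 \<le> p i" "p i \<le> 1" "0 \<le> p j" "p j \<le> 1" using less.prems ij by auto
    define B where "B = A - {i, j}"
    have AB: "A = insert i (insert j B)" "i \<notin> insert j B" "j \<notin> B" "finite B"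
      using ij neq A(1) by (auto simp: B_def)
    have pp': "p' k = p k" if "k \<in> B" for k using that by (auto simp: p'_def B_def)
    have pb: "poisson_binomial A r = [:1 - r i, r i:] * ([:1 - r j, r j:] * poisson_binomial B r)" for r
      unfolding AB(1) poisson_binomial_def using AB by (simp del: mult_pCons_left)
    have pB: "poisson_binomial B p' = poisson_binomial B p"
      unfolding poisson_binomial_def using pp' by (intro prod.cong) auto
    have "coeff_entropy (poisson_binomial A p) \<le> coeff_entropy (poisson_binomial A p')"
      unfolding pb pB
    proof (rule coeff_entropy_averaging)
      show "log_concave_seq (coeff (poisson_binomial B p))"
        using less.prems AB by (intro log_concave_poisson_binomial) auto
      have "p' i * p' j - p i * p j = (\<mu> - p i) * (p j - \<mu>)" unfolding p'ij by algebra
      moreover have "0 \<le> (\<mu> - p i) * (p j - \<mu>)" using ij by simp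
      ultimately show "p i * p j \<le> p' i * p' j" by linarith
    qed (use range ij p'ij in auto)
    also have "\<dots> \<le> coeff_entropy (poisson_binomial A (\<lambda>_. \<mu>))"
    proof (rule less.hyps)
      have "{k\<in>A. p' k \<noteq> \<mu>} \<subset> {k\<in>A. p k \<noteq> \<mu>}"
        using ij p'ij pp' AB(1) by auto
      then show "card {k\<in>A. p' k \<noteq> \<mu>} < card {k\<in>A. p k \<noteq> \<mu>}"
        using A(1) by (intro psubset_card_mono) auto
      show "0 \<le> p' k \<and> p' k \<le> 1" if "k \<in> A" for k
        using that less.prems(1)[of k] ij range by (auto simp: p'_def)
      have "(\<Sum>k\<in>A. r k) = r i + (r j + (\<Sum>k\<in>B. r k))" for r :: "_ \<Rightarrow> real"
        unfolding AB(1) using AB by simp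
      from this[of p] this[of p'] show "(\<Sum>k\<in>A. p' k) = real (card A) * \<mu>"
        using less.prems(2) pp' by (simp add: p'ij)
    qed
    finally show ?thesis .
  qed
qed

text \<open>Replacing all parameters by their mean gives a binomial law, and \<open>1/2\<close> is
  its best parameter. Empty \<open>A\<close> is separate because it has no mean.\<close>

lemma coeff_entropy_poisson_binomial_le:
  assumes A: "finite A" "\<And>i. i \<in> A \<Longrightarrow> 0 \<le> p i \<and> p i \<le> 1"
  shows "coeff_entropy (poisson_binomial A p) \<le> ln 2 * binomial_entropy (card A) (1/2)"
proof (cases "A = {}")
  case True
  then show ?thesis
    by (simp add: coeff_entropy_def poisson_binomial_def coeff_sum_def binomial_entropy_def)
next
  case False
  define \<mu> where "\<mu> = (\<Sum>i\<in>A. p i) / card A"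
  have card: "0 < card A" using False A by (simp add: card_gt_0_iff)
  have "(\<Sum>i\<in>A. p i) \<le> card A" "0 \<le> (\<Sum>i\<in>A. p i)"
    using sum_bounded_above[of A p 1] A by (auto intro!: sum_nonneg)
  then have \<mu>: "0 \<le> \<mu>" "\<mu> \<le> 1" using card by (auto simp: \<mu>_def field_simps)
  have "coeff_entropy (poisson_binomial A p) \<le> coeff_entropy (poisson_binomial A (\<lambda>_. \<mu>))"
    by (rule coeff_entropy_poisson_binomial_le_mean[OF A]) (use card in \<open>simp_all add: \<mu>_def\<close>)
  also have "\<dots> = binomial_entropy_nats (card A) \<mu>"
    by (simp only: poisson_binomial_const[OF A(1)] coeff_entropy_binomial)
  also have "\<dots> \<le> binomial_entropy_nats (card A) (1/2)" by (rule binomial_entropy_nats_le_half[OF \<mu>])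
  finally show ?thesis by (simp add: binomial_entropy_conv_nats)
qed

subsection \<open>Converse\<close>

lemma finite_message_tuples [simp]: "finite (message_tuples M)"
  unfolding message_tuples_def by (rule finite_PiE) auto

lemma card_message_tuples: "card (message_tuples M) = (\<Prod>i\<in>UNIV. M i)"
  by (simp add: message_tuples_def card_PiE)

lemma avg_error_prob_altdef:
  "avg_error_prob M n e d =
     real (card {m \<in> message_tuples M. d (received_word n e m) \<noteq> m}) / real (\<Prod>i\<in>UNIV. M i)"
proof -
  have "(\<Sum>m\<in>message_tuples M. of_bool (d (received_word n e m) \<noteq> m) :: real) =
      real (card (message_tuples M \<inter> {m. d (received_word n e m) \<noteq> m}))"
    by (rule sum_of_bool_eq) simp_all
  also have "message_tuples M \<inter> {m. d (received_word n e m) \<noteq> m} = {m \<in> message_tuples M. d (received_word n e m) \<noteq> m}"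
    by blast
  finally show ?thesis by (simp add: avg_error_prob_def)
qed

text \<open>Sums the tangent bound \<open>- ln u \<ge> ln c + 1 - c * u\<close> with
  \<open>c = card C / B\<close>: among weights of total mass at most \<open>B\<close>, the constant
  one minimises the sum.\<close>

lemma sum_neg_ln_ge:
  assumes "finite C" "\<And>x. x \<in> C \<Longrightarrow> 0 < q x" "(\<Sum>x\<in>C. q x) \<le> B" "0 < B"
  shows "card C * ln (card C / B) \<le> (\<Sum>x\<in>C. - ln (q x :: real))"
proof (cases "C = {}")
  case False
  define c where "c = card C / B"
  have c: "0 < c" using False assms by (simp add: c_def card_gt_0_iff)
  have "card C * ln c = (\<Sum>x\<in>C. ln c + 1) - c * B"
    using assms by (simp add: c_def algebra_simps)
  also have "\<dots> \<le> (\<Sum>x\<in>C. ln c + 1) - c * (\<Sum>x\<in>C. q x)"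
    using c assms by (intro diff_left_mono mult_left_mono) auto
  also have "\<dots> = (\<Sum>x\<in>C. ln c + 1 - c * q x)"
    by (simp add: sum_subtractf sum_distrib_left)
  also have "\<dots> \<le> (\<Sum>x\<in>C. - ln (q x))"
  proof (rule sum_mono)
    fix x assume "x \<in> C"
    then have "0 < q x" by (rule assms)
    then show "ln c + 1 - c * q x \<le> - ln (q x)"
      using ln_le_minus_one[of "c * q x"] c by (simp add: ln_mult)
  qed
  finally show ?thesis by (simp add: c_def)
qed simp

lemma monom_bit: "b \<in> {0, 1} \<Longrightarrow> monom 1 b = [:1 - real b, real b:]"
  by (auto simp: monom_0 monom_Suc)

lemma sum_linear_poly: "(\<Sum>a\<in>X. [:u a, v a:]) = [:(\<Sum>a\<in>X. u a), (\<Sum>a\<in>X. v a):]"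
  by (induction X rule: infinite_finite_induct) simp_all

lemma monom_one_sum: "monom 1 (\<Sum>i\<in>X. f i) = (\<Prod>i\<in>X. monom (1 :: real) (f i))"
  by (induction X rule: infinite_finite_induct) (simp_all add: one_pCons monom_0, metis mult_monom mult_1)

text \<open>The generating polynomial factors over the users. A user in \<open>A\<close> contributes
  a Bernoulli law whose parameter is the fraction of its messages with bit 1; any other user
  contributes only the factor \<open>M i\<close>.\<close>

lemma user_sum_distribution:
  fixes M :: "'s::finite \<Rightarrow> nat"
  assumes M: "\<And>i. 0 < M i" and bits: "\<And>i a. a \<in> {1..M i} \<Longrightarrow> x i a \<in> {0, 1 :: nat}"
  shows "(\<Sum>m\<in>message_tuples M. monom 1 (\<Sum>i\<in>A. x i (m i))) =
    smult (\<Prod>i\<in>UNIV. real (M i)) (poisson_binomial A (\<lambda>i. (\<Sum>a\<in>{1..M i}. real (x i a)) / real (M i)))"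
proof -
  let ?p = "\<lambda>i. (\<Sum>a\<in>{1..M i}. real (x i a)) / real (M i)"
  have "(\<Sum>m\<in>message_tuples M. monom 1 (\<Sum>i\<in>A. x i (m i))) =
     (\<Sum>m\<in>message_tuples M. \<Prod>i\<in>UNIV. if i \<in> A then monom (1 :: real) (x i (m i)) else 1)"
    by (simp add: monom_one_sum prod.If_cases)
  also have "\<dots> = (\<Prod>i\<in>UNIV. \<Sum>a\<in>{1..M i}. if i \<in> A then monom 1 (x i a) else 1)"
    unfolding message_tuples_def
    by (subst prod_sum_PiE) auto
  also have "\<dots> = (\<Prod>i\<in>UNIV. smult (real (M i)) (if i \<in> A then [:1 - ?p i, ?p i:] else 1))"
  proof (intro prod.cong refl)
    fix i
    have "(\<Sum>a\<in>{1..M i}. monom 1 (x i a)) = (\<Sum>a\<in>{1..M i}. [:1 - real (x i a), real (x i a):])"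
      by (intro sum.cong refl monom_bit bits)
    also have "\<dots> = smult (real (M i)) [:1 - ?p i, ?p i:]"
      using M[of i] by (simp add: sum_linear_poly sum_subtractf right_diff_distrib)
    finally show "(\<Sum>a\<in>{1..M i}. if i \<in> A then monom 1 (x i a) else 1) =
        smult (real (M i)) (if i \<in> A then [:1 - ?p i, ?p i:] else 1)"
      by (simp add: of_nat_poly)
  qed
  also have "\<dots> = smult (\<Prod>i\<in>UNIV. real (M i)) (poisson_binomial A ?p)"
    by (simp add: prod_smult poisson_binomial_def prod.If_cases)
  finally show ?thesis .
qed

text \<open>Takes the place of Fano's inequality: the sum of \<open>- ln (q (T m))\<close> over
  correctly decoded tuples is bounded below through their number and above through the entropies of
  the letters. With \<open>\<epsilon> < 1\<close>, \<open>C\<close> is nonempty and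
  \<open>ln (1 - \<epsilon>)\<close> is genuine.\<close>

lemma code_entropy_bound:
  fixes M :: "'s::finite \<Rightarrow> nat" and A :: "'s set"
  assumes M: "\<And>i. 0 < M i" and code: "is_code M n e d"
  defines "\<epsilon> \<equiv> avg_error_prob M n e d"
  assumes \<epsilon>: "\<epsilon> < 1"
  shows "(1 - \<epsilon>) * ((\<Sum>i\<in>A. ln (M i)) + ln (1 - \<epsilon>)) \<le> n * (ln 2 * binomial_entropy (card A) (1/2))"
proof -
  define Msg where "Msg = message_tuples M"
  define C where "C = {m \<in> Msg. d (received_word n e m) = m}"
  define S where "S j m = (\<Sum>i\<in>A. e i (m i) j)" for j m
  define p where "p j i = (\<Sum>a\<in>{1..M i}. real (e i a j)) / real (M i)" for j i
  define Q where "Q j = poisson_binomial A (p j)" for j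
  define N where "N = real (card Msg)"
  define B where "B = (\<Prod>i\<in>-A. M i)"
  define T where "T m = (\<lambda>j\<in>{1..n}. S j m)" for m
  define q where "q z = (\<Prod>j\<in>{1..n}. coeff (Q j) (z j))" for z
  have fin: "finite Msg" "finite C" by (simp_all add: Msg_def C_def)
  have N_eq: "N = (\<Prod>i\<in>UNIV. real (M i))" by (simp add: N_def Msg_def card_message_tuples)
  have N_pos: "0 < N" unfolding N_eq using M by (auto intro!: prod_pos)
  have bits: "e i a j \<in> {0, 1}" if "a \<in> {1..M i}" "j \<in> {1..n}" for i a j
    using code that by (auto simp: is_code_def PiE_def Pi_def)
  have S_le: "S j m \<le> card A" if "j \<in> {1..n}" "m \<in> Msg" for j m
  proof -
    have "e i (m i) j \<le> 1" for i
      using bits[of "m i" i j] that by (auto simp: Msg_def message_tuples_def PiE_def Pi_def)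
    then show ?thesis unfolding S_def using sum_bounded_above[of A "\<lambda>i. e i (m i) j" 1] by simp
  qed
  have law: "(\<Sum>m\<in>Msg. monom 1 (S j m)) = smult N (Q j)" if "j \<in> {1..n}" for j
    unfolding Msg_def S_def N_eq Q_def p_def by (rule user_sum_distribution) (use M bits that in auto)
  have law_sum: "(\<Sum>m\<in>Msg. g (S j m)) = N * coeff_sum (Q j) g" if "j \<in> {1..n}" for j g
    using arg_cong[OF law[OF that], of "\<lambda>F. coeff_sum F g"]
    by (simp add: coeff_sum_sum coeff_sum_monom coeff_sum_smult)
  have count: "N * coeff (Q j) k = card {m \<in> Msg. S j m = k}" if "j \<in> {1..n}" for j k
  proof -
    have "N * coeff (Q j) k = (\<Sum>m\<in>Msg. of_bool (S j m = k))"
      using arg_cong[OF law[OF that], of "\<lambda>F. coeff F k"] by (simp add: coeff_sum of_bool_def)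
    also have "\<dots> = card (Msg \<inter> {m. S j m = k})" using fin by simp
    also have "Msg \<inter> {m. S j m = k} = {m \<in> Msg. S j m = k}" by blast
    finally show ?thesis .
  qed
  have Q_nonneg: "0 \<le> coeff (Q j) k" if "j \<in> {1..n}" for j k
    using count[OF that, of k] N_pos by (metis of_nat_0_le_iff zero_le_mult_iff not_less)
  have Q_le: "coeff (Q j) k \<le> 1" if "j \<in> {1..n}" for j k
  proof -
    have "card {m \<in> Msg. S j m = k} \<le> card Msg" using fin by (intro card_mono) auto
    then have "N * coeff (Q j) k \<le> N * 1" unfolding count[OF that] by (simp add: N_def)
    then show ?thesis using N_pos by simp
  qed
  have Q_pos: "0 < coeff (Q j) (S j m)" if "j \<in> {1..n}" "m \<in> Msg" for j m
  proof -
    have "0 < card {m' \<in> Msg. S j m' = S j m}" using fin that by (auto simp: card_gt_0_iff)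
    then show ?thesis using count[OF that(1), of "S j m"] N_pos
      by (metis of_nat_0_less_iff zero_less_mult_pos)
  qed
  have q_pos: "0 < q (T m)" if "m \<in> Msg" for m
    unfolding q_def T_def using Q_pos[OF _ that] by (auto intro!: prod_pos)
  have q_nonneg: "0 \<le> q z" for z
    unfolding q_def using Q_nonneg by (auto intro!: prod_nonneg)
  have q_le: "q z \<le> 1" for z
    unfolding q_def using Q_nonneg Q_le by (auto intro!: prod_le_1)
  have q_sum: "(\<Sum>z\<in>{1..n} \<rightarrow>\<^sub>E {..card A}. q z) = 1"
  proof -
    have "(\<Sum>z\<in>{1..n} \<rightarrow>\<^sub>E {..card A}. q z) = (\<Prod>j\<in>{1..n}. \<Sum>k\<le>card A. coeff (Q j) k)"
      unfolding q_def by (subst prod_sum_PiE) auto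
    also have "\<dots> = (\<Prod>j\<in>{1..n}. coeff_sum (Q j) (\<lambda>_. 1))"
      unfolding Q_def by (simp add: coeff_sum_eq[OF degree_poisson_binomial_le])
    finally show ?thesis by (simp add: coeff_sum_one Q_def)
  qed
  have C_sub: "C \<subseteq> Msg" by (auto simp: C_def)
  have B_pos: "0 < B" unfolding B_def using M by (auto intro!: prod_pos)
  \<comment> \<open>Each word of sums arises from at most \<open>B\<close> tuples in
    \<open>C\<close>, one per choice of the messages outside \<open>A\<close>, and \<open>q\<close>
    has total mass 1.\<close>
  have "(\<Sum>m\<in>C. q (T m)) \<le> B"
  proof -
    define \<Phi> where "\<Phi> m = (restrict m (- A), T m)" for m
    have inj: "inj_on \<Phi> C"
    proof (rule inj_onI)
      fix m m' assume mm: "m \<in> C" "m' \<in> C" "\<Phi> m = \<Phi> m'"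
      have "m i = m' i" if "i \<in> - A" for i
        using mm(3) that unfolding \<Phi>_def by (metis Pair_inject restrict_apply')
      moreover have "S j m = S j m'" if "j \<in> {1..n}" for j
        using mm(3) that unfolding \<Phi>_def T_def by (metis Pair_inject restrict_apply')
      moreover have "adder_channel (\<lambda>i. e i (m i) j) = S j m + (\<Sum>i\<in>-A. e i (m i) j)" for m j
        unfolding adder_channel_def S_def
        by (subst sum.union_disjoint[symmetric]) auto
      ultimately have "received_word n e m = received_word n e m'"
        unfolding received_word_def by (intro restrict_ext) simp
      then show "m = m'" using mm(1,2) by (auto simp: C_def)
    qed
    have "(\<Sum>m\<in>C. q (T m)) = (\<Sum>x\<in>\<Phi> ` C. q (snd x))"
      unfolding sum.reindex[OF inj] by (simp add: \<Phi>_def)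
    also have "\<dots> \<le> (\<Sum>x\<in>(\<Pi>\<^sub>E i\<in>-A. {1..M i}) \<times> ({1..n} \<rightarrow>\<^sub>E {..card A}). q (snd x))"
    proof (rule sum_mono2)
      show "\<Phi> ` C \<subseteq> (\<Pi>\<^sub>E i\<in>-A. {1..M i}) \<times> ({1..n} \<rightarrow>\<^sub>E {..card A})"
        using C_sub S_le by (fastforce simp: \<Phi>_def T_def Msg_def message_tuples_def PiE_def Pi_def)
    qed (auto simp: finite_PiE q_nonneg)
    also have "\<dots> = (\<Sum>b\<in>(\<Pi>\<^sub>E i\<in>-A. {1..M i}). \<Sum>z\<in>{1..n} \<rightarrow>\<^sub>E {..card A}. q z)"
      unfolding sum.cartesian_product by (intro sum.cong) auto
    also have "\<dots> = B" unfolding q_sum by (simp add: card_PiE B_def)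
    finally show ?thesis .
  qed
  then have "card C * ln (card C / real B) \<le> (\<Sum>m\<in>C. - ln (q (T m)))"
    using fin C_sub q_pos B_pos by (intro sum_neg_ln_ge) auto
  \<comment> \<open>Since \<open>q \<le> 1\<close>, the added terms are nonnegative; over all tuples
    the \<open>j\<close>-th letter has exactly the law \<open>Q j\<close>, which turns the sum into
    entropies.\<close>
  also have "\<dots> \<le> (\<Sum>m\<in>Msg. - ln (q (T m)))"
    using fin C_sub q_pos q_le by (intro sum_mono2) auto
  also have "\<dots> = (\<Sum>m\<in>Msg. \<Sum>j\<in>{1..n}. - ln (coeff (Q j) (S j m)))"
  proof (intro sum.cong refl)
    fix m assume m: "m \<in> Msg"
    have "ln (q (T m)) = (\<Sum>j\<in>{1..n}. ln (coeff (Q j) (T m j)))"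
      unfolding q_def using Q_pos[OF _ m] by (intro ln_prod) (fastforce simp: T_def)+
    then show "- ln (q (T m)) = (\<Sum>j\<in>{1..n}. - ln (coeff (Q j) (S j m)))"
      by (simp add: sum_negf T_def)
  qed
  also have "\<dots> = (\<Sum>j\<in>{1..n}. N * coeff_entropy (Q j))"
  proof (subst sum.swap, intro sum.cong refl)
    fix j assume "j \<in> {1..n}"
    then show "(\<Sum>m\<in>Msg. - ln (coeff (Q j) (S j m))) = N * coeff_entropy (Q j)"
      using law_sum[of j "\<lambda>k. ln (coeff (Q j) k)"] by (simp add: sum_negf coeff_entropy_def)
  qed
  also have "\<dots> \<le> (\<Sum>j\<in>{1..n}. N * (ln 2 * binomial_entropy (card A) (1/2)))"
  proof (intro sum_mono mult_left_mono)
    fix j assume j: "j \<in> {1..n}"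
    show "coeff_entropy (Q j) \<le> ln 2 * binomial_entropy (card A) (1/2)"
      unfolding Q_def
    proof (rule coeff_entropy_poisson_binomial_le)
      fix i
      have "real (e i a j) \<le> 1" if "a \<in> {1..M i}" for a using bits[OF that j] by auto
      then have "(\<Sum>a\<in>{1..M i}. real (e i a j)) \<le> real (M i)"
        using sum_bounded_above[of "{1..M i}" "\<lambda>a. real (e i a j)" 1] by simp
      then show "0 \<le> p j i \<and> p j i \<le> 1"
        using M[of i] by (auto simp: p_def intro!: divide_nonneg_nonneg sum_nonneg)
    qed simp
  qed (use N_pos in auto)
  also have "\<dots> = N * (n * (ln 2 * binomial_entropy (card A) (1/2)))" by simp
  finally have main: "card C * ln (card C / B) \<le> N * (n * (ln 2 * binomial_entropy (card A) (1/2)))" .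
  have "card {m \<in> Msg. d (received_word n e m) \<noteq> m} = card Msg - card C"
    by (subst card_Diff_subset[symmetric]) (use fin C_sub in \<open>auto simp: C_def intro!: arg_cong[where f = card]\<close>)
  then have "\<epsilon> = (N - card C) / N"
    using card_mono[OF fin(1) C_sub]
    by (simp add: \<epsilon>_def avg_error_prob_altdef flip: card_message_tuples Msg_def)
      (simp add: N_def of_nat_diff)
  then have C_eq: "card C = (1 - \<epsilon>) * N" using N_pos by (simp add: field_simps)
  have "N = B * (\<Prod>i\<in>A. real (M i))"
    unfolding N_eq B_def of_nat_prod by (subst prod.union_disjoint[symmetric]) auto
  then have "card C / B = (\<Prod>i\<in>A. real (M i)) * (1 - \<epsilon>)" using B_pos by (simp add: C_eq)
  also have "ln \<dots> = (\<Sum>i\<in>A. ln (M i)) + ln (1 - \<epsilon>)"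
    using \<epsilon> M by (simp add: ln_mult ln_prod prod_pos)
  finally have "N * ((1 - \<epsilon>) * ((\<Sum>i\<in>A. ln (M i)) + ln (1 - \<epsilon>)))
      \<le> N * (n * (ln 2 * binomial_entropy (card A) (1/2)))"
    using main by (simp add: C_eq mult_ac)
  then show ?thesis using N_pos by simp
qed

section \<open>From block codes to rates\<close>

lemma codebook_sizes_ge: "2 powr (real n * R $ i) \<le> real (codebook_sizes R n i)"
  unfolding codebook_sizes_def by linarith

lemma codebook_sizes_pos: "0 < codebook_sizes R n i"
  unfolding codebook_sizes_def by (simp add: ceiling_less_iff)

text \<open>The entropy bound divided by \<open>n\<close>, in the limit:
  \<open>1 - \<epsilon> n\<close> tends to 1 and \<open>ln (1 - \<epsilon> n) / n\<close> to 0. The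
  bound applies once \<open>\<epsilon> n < 1\<close>, which holds eventually.\<close>

lemma achievable_imp_sum_le:
  fixes R :: "real ^ 's::finite"
  assumes "achievable R"
  shows "(\<Sum>i\<in>A. R $ i) \<le> binomial_entropy (card A) (1/2)"
proof -
  obtain e d where code: "\<And>n. 1 \<le> n \<Longrightarrow> is_code (codebook_sizes R n) n (e n) (d n)"
    and lim: "(\<lambda>n. avg_error_prob (codebook_sizes R n) n (e n) (d n)) \<longlonglongrightarrow> 0"
    using assms unfolding achievable_def by blast
  define \<epsilon> where "\<epsilon> n = avg_error_prob (codebook_sizes R n) n (e n) (d n)" for n
  have \<epsilon>: "\<epsilon> \<longlonglongrightarrow> 0" using lim by (simp add: \<epsilon>_def[abs_def])
  let ?h = "ln 2 * binomial_entropy (card A) (1/2)"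
  have "(\<lambda>n. (1 - \<epsilon> n) * (ln 2 * (\<Sum>i\<in>A. R $ i) + ln (1 - \<epsilon> n) * (1 / real n)))
     \<longlonglongrightarrow> (1 - 0) * (ln 2 * (\<Sum>i\<in>A. R $ i) + ln (1 - 0) * 0)"
    by (intro tendsto_intros \<epsilon> lim_1_over_n) auto
  moreover have "\<forall>\<^sub>F n in sequentially. \<epsilon> n < 1"
    using \<epsilon> by (rule order_tendstoD) simp
  then have "\<forall>\<^sub>F n in sequentially.
      (1 - \<epsilon> n) * (ln 2 * (\<Sum>i\<in>A. R $ i) + ln (1 - \<epsilon> n) * (1 / real n)) \<le> ?h"
    using eventually_ge_at_top[of 1]
  proof eventually_elim
    case (elim n)
    have "ln 2 * real n * R $ i \<le> ln (codebook_sizes R n i)" for i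
    proof -
      have "ln (2 powr (real n * R $ i)) \<le> ln (codebook_sizes R n i)"
        using codebook_sizes_pos[of R n i] by (subst ln_le_cancel_iff) (auto simp: codebook_sizes_ge)
      then show ?thesis by (simp add: ln_powr mult_ac)
    qed
    then have "(1 - \<epsilon> n) * ((\<Sum>i\<in>A. ln 2 * real n * R $ i) + ln (1 - \<epsilon> n))
        \<le> (1 - \<epsilon> n) * ((\<Sum>i\<in>A. ln (codebook_sizes R n i)) + ln (1 - \<epsilon> n))"
      using elim by (intro mult_left_mono add_right_mono sum_mono) auto
    also have "\<dots> \<le> n * ?h"
      using code_entropy_bound[OF codebook_sizes_pos code[OF elim(2)]] elim unfolding \<epsilon>_def by blast
    also have "(\<Sum>i\<in>A. ln 2 * real n * R $ i) + ln (1 - \<epsilon> n)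
        = n * (ln 2 * (\<Sum>i\<in>A. R $ i) + ln (1 - \<epsilon> n) * (1 / real n))"
      using elim by (simp add: sum_distrib_left[symmetric] sum_distrib_right[symmetric] field_simps)
    finally have "n * ((1 - \<epsilon> n) * (ln 2 * (\<Sum>i\<in>A. R $ i) + ln (1 - \<epsilon> n) * (1 / real n))) \<le> n * ?h"
      by (simp only: mult.left_commute)
    then show ?case using elim by (simp only: mult_le_cancel_left_pos of_nat_0_less_iff)
  qed
  ultimately have "(1 - 0) * (ln 2 * (\<Sum>i\<in>A. R $ i) + ln (1 - 0) * 0) \<le> ?h"
    by (rule tendsto_upperbound) simp
  then show ?thesis by simp
qed

subsection \<open>Achievability\<close>

text \<open>Independence of fair bits on disjoint blocks in counting form, multiplied out to stay in
  the naturals. The induction splits a set into its part in the new block and the rest, which can be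
  chosen independently.\<close>

lemma card_subsets_with_intersections:
  assumes "finite T" "finite I" "\<And>t. t \<in> T \<Longrightarrow> J t \<subseteq> I"
    "\<And>s t. s \<in> T \<Longrightarrow> t \<in> T \<Longrightarrow> s \<noteq> t \<Longrightarrow> J s \<inter> J t = {}"
  shows "card {X \<in> Pow I. \<forall>t\<in>T. card (X \<inter> J t) = z t} * 2 ^ (\<Sum>t\<in>T. card (J t))
    = 2 ^ card I * (\<Prod>t\<in>T. card (J t) choose z t)"
  using assms
proof (induction T arbitrary: I)
  case empty
  have "{X \<in> Pow I. \<forall>t\<in>{}. card (X \<inter> J t) = z t} = Pow I" by auto
  with empty show ?case by (simp add: card_Pow)
next
  case (insert t T)
  let ?I = "I - J t"
  have Jt: "J t \<subseteq> I" "finite (J t)" using insert.prems(1,2) by (auto intro: finite_subset)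
  have disj: "J s \<inter> J t = {}" if "s \<in> T" for s using insert.prems(3)[of s t] insert.hyps that by auto
  have split: "(X - J t) \<inter> J s = X \<inter> J s" if "s \<in> T" for s X using disj[OF that] by auto
  let ?L = "{X \<in> Pow I. \<forall>s\<in>insert t T. card (X \<inter> J s) = z s}"
  let ?U = "{Y. Y \<subseteq> J t \<and> card Y = z t}" and ?V = "{X \<in> Pow ?I. \<forall>s\<in>T. card (X \<inter> J s) = z s}"
  have "bij_betw (\<lambda>X. (X \<inter> J t, X - J t)) ?L (?U \<times> ?V)"
  proof (rule bij_betwI[where g = "\<lambda>(Y, X). Y \<union> X"])
    show "(\<lambda>X. (X \<inter> J t, X - J t)) \<in> ?L \<rightarrow> ?U \<times> ?V" using split by auto
    show "(\<lambda>(Y, X). Y \<union> X) \<in> ?U \<times> ?V \<rightarrow> ?L"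
    proof
      fix YX assume "YX \<in> ?U \<times> ?V"
      then obtain Y X where YX: "YX = (Y, X)" "Y \<subseteq> J t" "card Y = z t" "X \<subseteq> ?I"
        "\<forall>s\<in>T. card (X \<inter> J s) = z s" by blast
      have "(Y \<union> X) \<inter> J t = Y" using YX by auto
      moreover have "(Y \<union> X) \<inter> J s = X \<inter> J s" if "s \<in> T" for s using disj[OF that] YX by auto
      ultimately have "Y \<union> X \<in> ?L" using YX Jt by auto
      then show "(case YX of (Y, X) \<Rightarrow> Y \<union> X) \<in> ?L" using YX(1) by simp
    qed
  next
    fix X show "(case (X \<inter> J t, X - J t) of (Y, X) \<Rightarrow> Y \<union> X) = X" by auto
  next
    fix YX assume "YX \<in> ?U \<times> ?V"
    then obtain Y X where "YX = (Y, X)" "Y \<subseteq> J t" "X \<subseteq> ?I" by blast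
    then show "((case YX of (Y, X) \<Rightarrow> Y \<union> X) \<inter> J t, (case YX of (Y, X) \<Rightarrow> Y \<union> X) - J t) = YX" by auto
  qed
  then have "card ?L = card (?U \<times> ?V)" by (rule bij_betw_same_card)
  also have "\<dots> = (card (J t) choose z t) * card ?V"
    using n_subsets[OF Jt(2), of "z t"] by (simp add: card_cartesian_product)
  finally have L: "card ?L = (card (J t) choose z t) * card ?V" .
  have IH: "card ?V * 2 ^ (\<Sum>s\<in>T. card (J s)) = 2 ^ card ?I * (\<Prod>s\<in>T. card (J s) choose z s)"
  proof (rule insert.IH)
    show "J s \<subseteq> ?I" if "s \<in> T" for s using insert.prems(2)[of s] disj[OF that] that by blast
    show "J s \<inter> J u = {}" if "s \<in> T" "u \<in> T" "s \<noteq> u" for s u using insert.prems(3) that by blast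
  qed (use insert.prems(1) in simp)
  have I: "2 ^ card I = (2::nat) ^ card (J t) * 2 ^ card ?I"
    using Jt insert.prems(1) by (simp add: card_Diff_subset card_mono flip: power_add)
  have "card ?L * 2 ^ (\<Sum>s\<in>insert t T. card (J s)) =
      (card (J t) choose z t) * 2 ^ card (J t) * (card ?V * 2 ^ (\<Sum>s\<in>T. card (J s)))"
    unfolding L sum.insert[OF insert.hyps] power_add by (simp only: mult_ac)
  also have "\<dots> = 2 ^ card I * (\<Prod>s\<in>insert t T. card (J s) choose z s)"
    unfolding IH I prod.insert[OF insert.hyps] by (simp only: mult_ac)
  finally show ?case .
qed

lemma Bernstein_half: "Bernstein n k (1/2) = real (n choose k) / 2 ^ n"
proof (cases "k \<le> n")
  case True
  then have "(1/2 :: real) ^ k * (1/2) ^ (n - k) = 1 / 2 ^ n"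
    by (simp add: power_one_over flip: power_add)
  then show ?thesis by (simp add: Bernstein_def mult.assoc)
qed (simp add: Bernstein_def binomial_eq_0)

lemma card_subsets_with_intersections_half:
  assumes "finite T" "finite I" "\<And>t. t \<in> T \<Longrightarrow> J t \<subseteq> I"
    "\<And>s t. s \<in> T \<Longrightarrow> t \<in> T \<Longrightarrow> s \<noteq> t \<Longrightarrow> J s \<inter> J t = {}"
  shows "real (card {X \<in> Pow I. \<forall>t\<in>T. card (X \<inter> J t) = z t})
    = 2 ^ card I * (\<Prod>t\<in>T. Bernstein (card (J t)) (z t) (1/2))"
proof -
  have "real (card {X \<in> Pow I. \<forall>t\<in>T. card (X \<inter> J t) = z t}) * 2 ^ (\<Sum>t\<in>T. card (J t)) =
      2 ^ card I * (\<Prod>t\<in>T. real (card (J t) choose z t))"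
    using arg_cong[OF card_subsets_with_intersections[OF assms, where z = z], where f = real] by simp
  moreover have "(\<Prod>t\<in>T. 2 ^ card (J t) :: real) \<noteq> 0" by (simp add: assms(1))
  ultimately show ?thesis
    by (simp add: Bernstein_half prod_dividef power_sum field_simps)
qed

text \<open>The hypotheses bound \<open>y\<close> by \<open>min 1 x * c\<close>, and
  \<open>min 1 x \<le> x powr \<theta>\<close> for exponents in the unit interval.\<close>

lemma min_le_powr:
  assumes "0 \<le> \<theta>" "\<theta> \<le> 1" "0 < x" "0 \<le> c" "y \<le> c" "y \<le> x * c"
  shows "y \<le> x powr \<theta> * (c :: real)"
proof (cases "1 \<le> x")
  case True
  then have "1 * c \<le> x powr \<theta> * c" using assms by (intro mult_right_mono ge_one_powr_ge_zero) auto
  with assms show ?thesis by simp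
next
  case False
  then have "x powr 1 \<le> x powr \<theta>" using assms by (intro powr_mono') auto
  then have "x * c \<le> x powr \<theta> * c" using assms by (intro mult_right_mono) auto
  with assms show ?thesis by simp
qed

text \<open>A codebook is drawn by choosing uniformly the set \<open>X\<close> of triples (user, message, time)
  at which the transmitted bit is \<open>1\<close>.\<close>
definition code_positions :: "('s::finite \<Rightarrow> nat) \<Rightarrow> nat \<Rightarrow> ('s \<times> nat \<times> nat) set" where
  "code_positions M n = (SIGMA i:UNIV. {1..M i} \<times> {1..n})"

text \<open>Phrased as the size of an intersection so that the counting lemma applies; it is the sum
  of the bits sent by the users in \<open>A\<close>.\<close>

definition partial_sum :: "('s \<times> nat \<times> nat) set \<Rightarrow> 's set \<Rightarrow> ('s \<Rightarrow> nat) \<Rightarrow> nat \<Rightarrow> nat" where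
  "partial_sum X A m j = card (X \<inter> (\<lambda>i. (i, m i, j)) ` A)"

section \<open>Counting random codebooks\<close>

lemma finite_code_positions [simp]: "finite (code_positions M n)"
  by (auto simp: code_positions_def)

lemma partial_sum_le: "finite A \<Longrightarrow> partial_sum X A m j \<le> card A"
  unfolding partial_sum_def
  by (rule order_trans[OF card_mono[OF _ Int_lower2] card_image_le]) auto

lemma partial_sum_eq_sum: "finite A \<Longrightarrow> partial_sum X A m j = (\<Sum>i\<in>A. of_bool ((i, m i, j) \<in> X))"
proof -
  assume A: "finite A"
  have "X \<inter> (\<lambda>i. (i, m i, j)) ` A = (\<lambda>i. (i, m i, j)) ` (A \<inter> {i. (i, m i, j) \<in> X})" by auto
  moreover have "inj_on (\<lambda>i. (i, m i, j)) (A \<inter> {i. (i, m i, j) \<in> X})" by (auto simp: inj_on_def)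
  ultimately show ?thesis using A by (simp add: partial_sum_def card_image)
qed

lemma codeword_positions_subset:
  "m \<in> message_tuples M \<Longrightarrow> j \<in> {1..n} \<Longrightarrow> (\<lambda>i. (i, m i, j)) ` A \<subseteq> code_positions M n"
  by (auto simp: message_tuples_def code_positions_def)

text \<open>The positions read at different times form disjoint blocks of size
  \<open>card A\<close>.\<close>

lemma card_codebooks_single:
  fixes A :: "'s::finite set"
  assumes "m \<in> message_tuples M"
  shows "real (card {X \<in> Pow (code_positions M n). \<forall>j\<in>{1..n}. partial_sum X A m j = z j}) =
    2 ^ card (code_positions M n) * (\<Prod>j\<in>{1..n}. Bernstein (card A) (z j) (1/2))"
proof -
  have "card ((\<lambda>i. (i, m i, j)) ` A) = card A" for j :: nat by (intro card_image) (auto simp: inj_on_def)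
  moreover have "real (card {X \<in> Pow (code_positions M n). \<forall>j\<in>{1..n}. partial_sum X A m j = z j}) =
    2 ^ card (code_positions M n) * (\<Prod>j\<in>{1..n}. Bernstein (card ((\<lambda>i. (i, m i, j)) ` A)) (z j) (1/2))"
    unfolding partial_sum_def
  proof (rule card_subsets_with_intersections_half)
    show "(\<lambda>i. (i, m i, j)) ` A \<subseteq> code_positions M n" if "j \<in> {1..n}" for j
      using codeword_positions_subset[OF assms that] .
  qed auto
  ultimately show ?thesis by (simp only:)
qed

text \<open>As the tuples differ at every user of \<open>A\<close>, they read disjoint positions at
  each time; the two words of sums are independent, hence the square.\<close>

lemma card_codebooks_pair:
  fixes A :: "'s::finite set"
  assumes "m \<in> message_tuples M" "m' \<in> message_tuples M" "\<And>i. i \<in> A \<Longrightarrow> m i \<noteq> m' i"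
  shows "real (card {X \<in> Pow (code_positions M n).
      \<forall>j\<in>{1..n}. partial_sum X A m j = z j \<and> partial_sum X A m' j = z j}) =
    2 ^ card (code_positions M n) * (\<Prod>j\<in>{1..n}. Bernstein (card A) (z j) (1/2))\<^sup>2"
proof -
  \<comment> \<open>One block for each time and each tuple, the boolean selecting \<open>m\<close>
    or \<open>m'\<close>.\<close>
  define J where "J t = (\<lambda>i. (i, (if snd t then m else m') i, fst t)) ` A" for t :: "nat \<times> bool"
  have ne: "m i \<noteq> m' i" "m' i \<noteq> m i" if "i \<in> A" for i using assms(3)[OF that] by auto
  have card_J: "card (J t) = card A" for t unfolding J_def by (intro card_image) (auto simp: inj_on_def)
  have "real (card {X \<in> Pow (code_positions M n). \<forall>t\<in>{1..n} \<times> UNIV. card (X \<inter> J t) = z (fst t)}) =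
     2 ^ card (code_positions M n) * (\<Prod>t\<in>{1..n} \<times> UNIV. Bernstein (card (J t)) (z (fst t)) (1/2))"
  proof (rule card_subsets_with_intersections_half)
    fix t :: "nat \<times> bool" assume "t \<in> {1..n} \<times> UNIV"
    then show "J t \<subseteq> code_positions M n"
      using assms(1,2) by (auto simp: J_def message_tuples_def code_positions_def)
  next
    fix s t :: "nat \<times> bool" assume "s \<noteq> t"
    then have "fst s \<noteq> fst t \<or> snd t = (\<not> snd s)" by (auto simp: prod_eq_iff)
    then show "J s \<inter> J t = {}"
      unfolding J_def by (cases "snd s") (auto simp: ne split: if_splits)
  qed auto
  also have "(\<Prod>t\<in>{1..n} \<times> (UNIV :: bool set). Bernstein (card (J t)) (z (fst t)) (1/2)) =
      (\<Prod>j\<in>{1..n}. \<Prod>c\<in>(UNIV :: bool set). Bernstein (card A) (z j) (1/2))"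
    unfolding prod.cartesian_product card_J by (intro prod.cong) auto
  also have "\<dots> = (\<Prod>j\<in>{1..n}. Bernstein (card A) (z j) (1/2))\<^sup>2"
    by (simp add: prod_power_distrib[symmetric] power2_eq_square prod.distrib)
  also have "{X \<in> Pow (code_positions M n). \<forall>t\<in>{1..n} \<times> UNIV. card (X \<inter> J t) = z (fst t)} =
      {X \<in> Pow (code_positions M n). \<forall>j\<in>{1..n}. partial_sum X A m j = z j \<and> partial_sum X A m' j = z j}"
  proof -
    have "(\<forall>t\<in>{1..n} \<times> UNIV. Q t) \<longleftrightarrow> (\<forall>j\<in>{1..n}. Q (j, True) \<and> Q (j, False))" for Q
      unfolding Ball_def split_paired_All by (auto simp: all_bool_eq)
    then show ?thesis by (simp add: partial_sum_def J_def all_bool_eq)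
  qed
  finally show ?thesis .
qed

text \<open>For \<open>\<theta> > 0\<close>, the exponential of \<open>- \<theta>\<close> times the
  Renyi entropy of order \<open>1 + \<theta>\<close>, in nats, of the fair binomial law.\<close>

definition renyi_sum :: "nat \<Rightarrow> real \<Rightarrow> real" where
  "renyi_sum k \<theta> = (\<Sum>l\<le>k. Bernstein k l (1/2) powr (1 + \<theta>))"

text \<open>For fixed \<open>z\<close>, the union bound over \<open>m'\<close> and the trivial bound by the probability of \<open>z\<close>
  are interpolated by the exponent \<open>\<theta>\<close> (Gallager).\<close>
lemma card_colliding_codebooks:
  fixes A :: "'s::finite set"
  assumes m: "m \<in> message_tuples M" and \<theta>: "0 \<le> \<theta>" "\<theta> \<le> 1"
  shows "real (card {X \<in> Pow (code_positions M n).
      \<exists>m'\<in>message_tuples M. {i. m i \<noteq> m' i} = A \<and> (\<forall>j\<in>{1..n}. partial_sum X A m j = partial_sum X A m' j)})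
    \<le> 2 ^ card (code_positions M n) * ((\<Prod>i\<in>A. real (M i)) powr \<theta> * renyi_sum (card A) \<theta> ^ n)"
proof -
  define I where "I = code_positions M n"
  define D where "D = {m' \<in> message_tuples M. {i. m i \<noteq> m' i} = A}"
  define P where "P z = (\<Prod>j\<in>{1..n}. Bernstein (card A) (z j) (1/2))" for z :: "nat \<Rightarrow> nat"
  define Zs where "Zs = {1..n} \<rightarrow>\<^sub>E {..card A}"
  define F where "F z = {X \<in> Pow I. (\<forall>j\<in>{1..n}. partial_sum X A m j = z j) \<and>
    (\<exists>m'\<in>D. \<forall>j\<in>{1..n}. partial_sum X A m' j = z j)}" for z
  let ?MA = "\<Prod>i\<in>A. M i"
  have Mpos: "0 < M i" for i
  proof -
    have "m i \<in> {1..M i}" using m by (auto simp: message_tuples_def)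
    then show ?thesis by simp
  qed
  have MA: "0 < ?MA" using Mpos by (auto intro!: prod_pos)
  \<comment> \<open>A tuple in \<open>D\<close> agrees with \<open>m\<close> outside
    \<open>A\<close>, so its restriction to \<open>A\<close> determines it.\<close>
  have "card D \<le> card (\<Pi>\<^sub>E i\<in>A. {1..M i})"
  proof (rule card_inj_on_le[of "\<lambda>m'. restrict m' A"])
    show "inj_on (\<lambda>m'. restrict m' A) D"
    proof (rule inj_onI)
      fix u v assume uv: "u \<in> D" "v \<in> D" "restrict u A = restrict v A"
      show "u = v"
      proof
        fix i
        have "restrict u A i = restrict v A i" using uv(3) by simp
        moreover have "i \<notin> A \<Longrightarrow> m i = u i" "i \<notin> A \<Longrightarrow> m i = v i" using uv(1,2) by (auto simp: D_def)
        ultimately show "u i = v i" by (cases "i \<in> A") auto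
      qed
    qed
  qed (auto simp: D_def message_tuples_def intro!: finite_PiE)
  then have card_D: "card D \<le> ?MA" by (simp add: card_PiE)
  have finD: "finite D" by (simp add: D_def)
  have P_pos: "0 < P z" if "z \<in> Zs" for z
    unfolding P_def by (rule prod_pos) (use that in \<open>auto simp: Zs_def PiE_def Pi_def intro!: Bernstein_pos\<close>)
  have F_le: "real (card (F z)) \<le> 2 ^ card I * (real ?MA powr \<theta> * P z powr (1 + \<theta>))" if z: "z \<in> Zs" for z
  proof -
    have "card (F z) \<le> card {X \<in> Pow I. \<forall>j\<in>{1..n}. partial_sum X A m j = z j}"
      by (intro card_mono) (auto simp: F_def I_def)
    then have le1: "real (card (F z)) \<le> 2 ^ card I * P z"
      unfolding I_def P_def card_codebooks_single[OF m, symmetric] by simp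
    have "F z \<subseteq> (\<Union>m'\<in>D. {X \<in> Pow I. \<forall>j\<in>{1..n}. partial_sum X A m j = z j \<and> partial_sum X A m' j = z j})"
      by (auto simp: F_def)
    then have "card (F z) \<le>
        card (\<Union>m'\<in>D. {X \<in> Pow I. \<forall>j\<in>{1..n}. partial_sum X A m j = z j \<and> partial_sum X A m' j = z j})"
      using finD by (intro card_mono) (auto simp: I_def)
    also have "\<dots> \<le>
        (\<Sum>m'\<in>D. card {X \<in> Pow I. \<forall>j\<in>{1..n}. partial_sum X A m j = z j \<and> partial_sum X A m' j = z j})"
      by (rule card_UN_le[OF finD])
    finally have "real (card (F z)) \<le>
        (\<Sum>m'\<in>D. real (card {X \<in> Pow I. \<forall>j\<in>{1..n}. partial_sum X A m j = z j \<and> partial_sum X A m' j = z j}))"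
      by (simp only: of_nat_le_iff flip: of_nat_sum)
    also have "\<dots> = (\<Sum>m'\<in>D. 2 ^ card I * (P z)\<^sup>2)"
      unfolding I_def P_def by (intro sum.cong refl card_codebooks_pair m) (auto simp: D_def)
    also have "\<dots> = real (card D) * (2 ^ card I * (P z)\<^sup>2)" by simp
    also have "\<dots> \<le> real ?MA * (2 ^ card I * (P z)\<^sup>2)"
      using card_D by (intro mult_right_mono) (auto simp del: of_nat_prod)
    finally have "real (card (F z)) \<le> (real ?MA * P z) * (2 ^ card I * P z)"
      by (simp add: power2_eq_square mult_ac)
    \<comment> \<open>Here \<open>c\<close> is the bound \<open>le1\<close> and \<open>x * c\<close>
      the union bound, with \<open>x = real ?MA * P z\<close>; the factor
      \<open>P z powr \<theta>\<close> produces the exponent \<open>1 + \<theta>\<close>.\<close>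
    then have "real (card (F z)) \<le> (real ?MA * P z) powr \<theta> * (2 ^ card I * P z)"
      using le1 P_pos[OF z] MA \<theta> by (intro min_le_powr) (auto simp del: of_nat_prod)
    also have "\<dots> = 2 ^ card I * (real ?MA powr \<theta> * P z powr (1 + \<theta>))"
      using P_pos[OF z] MA by (simp add: powr_mult powr_add mult_ac del: of_nat_prod)
    finally show ?thesis .
  qed
  have "{X \<in> Pow I. \<exists>m'\<in>message_tuples M. {i. m i \<noteq> m' i} = A \<and>
      (\<forall>j\<in>{1..n}. partial_sum X A m j = partial_sum X A m' j)} \<subseteq> (\<Union>z\<in>Zs. F z)"
  proof
    fix X
    assume "X \<in> {X \<in> Pow I. \<exists>m'\<in>message_tuples M. {i. m i \<noteq> m' i} = A \<and>
      (\<forall>j\<in>{1..n}. partial_sum X A m j = partial_sum X A m' j)}"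
    then obtain m' where X: "X \<in> Pow I" "m' \<in> D"
      "\<And>j. j \<in> {1..n} \<Longrightarrow> partial_sum X A m j = partial_sum X A m' j"
      unfolding D_def by blast
    let ?z = "\<lambda>j\<in>{1..n}. partial_sum X A m j"
    have "?z \<in> Zs" by (auto simp: Zs_def partial_sum_le)
    moreover have "X \<in> F ?z" using X by (auto simp: F_def intro!: bexI[of _ m'])
    ultimately show "X \<in> (\<Union>z\<in>Zs. F z)" by blast
  qed
  then have "card {X \<in> Pow I. \<exists>m'\<in>message_tuples M. {i. m i \<noteq> m' i} = A \<and>
      (\<forall>j\<in>{1..n}. partial_sum X A m j = partial_sum X A m' j)} \<le> card (\<Union>z\<in>Zs. F z)"
    by (intro card_mono) (auto simp: Zs_def F_def I_def intro!: finite_PiE)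
  also have "\<dots> \<le> (\<Sum>z\<in>Zs. card (F z))"
    by (rule card_UN_le) (auto simp: Zs_def intro!: finite_PiE)
  finally have "real (card {X \<in> Pow I. \<exists>m'\<in>message_tuples M. {i. m i \<noteq> m' i} = A \<and>
      (\<forall>j\<in>{1..n}. partial_sum X A m j = partial_sum X A m' j)}) \<le> (\<Sum>z\<in>Zs. real (card (F z)))"
    by (simp only: of_nat_le_iff flip: of_nat_sum)
  also have "\<dots> \<le> (\<Sum>z\<in>Zs. 2 ^ card I * (real ?MA powr \<theta> * P z powr (1 + \<theta>)))"
    by (intro sum_mono F_le)
  also have "\<dots> = 2 ^ card I * (real ?MA powr \<theta> * (\<Sum>z\<in>Zs. P z powr (1 + \<theta>)))"
    by (simp add: sum_distrib_left)
  \<comment> \<open>\<open>P\<close> is a product over the times, so the sum over words becomes a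
    product of \<open>n\<close> equal sums.\<close>
  also have "(\<Sum>z\<in>Zs. P z powr (1 + \<theta>)) =
      (\<Sum>z\<in>Zs. \<Prod>j\<in>{1..n}. Bernstein (card A) (z j) (1/2) powr (1 + \<theta>))"
    unfolding P_def by (intro sum.cong refl prod_powr_distrib)
  also have "\<dots> = renyi_sum (card A) \<theta> ^ n"
    unfolding Zs_def renyi_sum_def by (subst prod_sum_PiE[symmetric]) auto
  finally show ?thesis by (simp add: I_def)
qed

text \<open>Probabilistic method: the bound holds for the average over all codebooks
  \<open>X\<close>, hence for some \<open>X\<close>. The exponent may vary with the set
  \<open>A\<close> of wrongly decoded users.\<close>

lemma ex_code_error_le:
  fixes M :: "'s::finite \<Rightarrow> nat"
  assumes M: "\<And>i. 0 < M i" and \<theta>: "\<And>A. 0 \<le> \<theta> A \<and> \<theta> A \<le> 1"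
  shows "\<exists>e d. is_code M n e d \<and> avg_error_prob M n e d \<le>
    (\<Sum>A\<in>UNIV - {{}}. (\<Prod>i\<in>A. real (M i)) powr \<theta> A * renyi_sum (card A) (\<theta> A) ^ n)"
proof -
  define I where "I = code_positions M n"
  define Msg where "Msg = message_tuples M"
  define b where "b A = (\<Prod>i\<in>A. real (M i)) powr \<theta> A * renyi_sum (card A) (\<theta> A) ^ n" for A :: "'s set"
  define \<beta> where "\<beta> = (\<Sum>A\<in>UNIV - {{}}. b A)"
  define e where "e X i a = (\<lambda>j\<in>{1..n}. of_bool ((i, a, j) \<in> X) :: nat)" for X :: "('s \<times> nat \<times> nat) set" and i a
  \<comment> \<open>The decoder picks any tuple consistent with \<open>y\<close>. For other words it
    returns the all-ones tuple, a legal value because every \<open>M i\<close> is positive.\<close>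
  define d where "d X y = (if \<exists>m\<in>Msg. received_word n (e X) m = y
     then SOME m. m \<in> Msg \<and> received_word n (e X) m = y else (\<lambda>_. 1))" for X y
  define coll where "coll A m X \<longleftrightarrow> (\<exists>m'\<in>Msg. {i. m i \<noteq> m' i} = A \<and>
      (\<forall>j\<in>{1..n}. partial_sum X A m j = partial_sum X A m' j))" for A m X
  have fin: "finite Msg" "finite I" by (simp_all add: Msg_def I_def)
  have d_some: "d X y \<in> Msg \<and> received_word n (e X) (d X y) = y"
    if "m \<in> Msg" "received_word n (e X) m = y" for X y m
  proof -
    have "\<exists>m. m \<in> Msg \<and> received_word n (e X) m = y" using that by blast
    from someI_ex[OF this] show ?thesis using that by (auto simp: d_def)
  qed
  have d_Msg: "d X y \<in> Msg" for X y
  proof (cases "\<exists>m\<in>Msg. received_word n (e X) m = y")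
    case False
    then have "d X y = (\<lambda>_. 1)" by (simp add: d_def)
    then show ?thesis using M by (auto simp: Msg_def message_tuples_def Suc_le_eq)
  qed (use d_some in blast)
  have code: "is_code M n (e X) (d X)" for X
    using d_Msg unfolding is_code_def Msg_def by (auto simp: e_def PiE_def Pi_def extensional_def)
  \<comment> \<open>On an error the decoded tuple produces the same word as \<open>m\<close>. Users
    on which the two agree cancel, so they collide on the nonempty set where they differ.\<close>
  have error: "\<exists>A\<in>UNIV - {{}}. coll A m X" if m: "m \<in> Msg" "d X (received_word n (e X) m) \<noteq> m" for m X
  proof -
    define m' where "m' = d X (received_word n (e X) m)"
    have m': "m' \<in> Msg" "received_word n (e X) m' = received_word n (e X) m" "m' \<noteq> m"
      using d_some[OF m(1) refl, of X] m(2) by (auto simp: m'_def)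
    let ?A = "{i. m i \<noteq> m' i}"
    have "partial_sum X ?A m j = partial_sum X ?A m' j" if j: "j \<in> {1..n}" for j
    proof -
      have split: "adder_channel (\<lambda>i. e X i (u i) j) = partial_sum X ?A u j + (\<Sum>i\<in>-?A. e X i (u i) j)" for u
      proof -
        have "adder_channel (\<lambda>i. e X i (u i) j) = (\<Sum>i\<in>?A. e X i (u i) j) + (\<Sum>i\<in>-?A. e X i (u i) j)"
          unfolding adder_channel_def by (subst sum.union_disjoint[symmetric]) (auto simp: Un_def)
        then show ?thesis using j by (simp add: partial_sum_eq_sum e_def)
      qed
      have "adder_channel (\<lambda>i. e X i (m' i) j) = adder_channel (\<lambda>i. e X i (m i) j)"
        using fun_cong[OF m'(2), of j] j by (simp add: received_word_def)
      moreover have "(\<Sum>i\<in>-?A. e X i (m i) j) = (\<Sum>i\<in>-?A. e X i (m' i) j)" by (intro sum.cong) auto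
      ultimately show ?thesis unfolding split by simp
    qed
    then have "coll ?A m X" unfolding coll_def using m' by blast
    moreover have "?A \<noteq> {}" using m'(3) by auto
    ultimately show ?thesis by blast
  qed
  define err where "err X = card {m \<in> Msg. d X (received_word n (e X) m) \<noteq> m}" for X
  have err_le: "real (err X) \<le> (\<Sum>m\<in>Msg. \<Sum>A\<in>UNIV - {{}}. of_bool (coll A m X))" for X
  proof -
    have "real (err X) = (\<Sum>m\<in>{m \<in> Msg. d X (received_word n (e X) m) \<noteq> m}. 1)"
      by (simp add: err_def)
    also have "\<dots> \<le> (\<Sum>m\<in>{m \<in> Msg. d X (received_word n (e X) m) \<noteq> m}. \<Sum>A\<in>UNIV - {{}}. of_bool (coll A m X))"
    proof (rule sum_mono)
      fix m assume "m \<in> {m \<in> Msg. d X (received_word n (e X) m) \<noteq> m}"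
      then obtain A where A: "A \<in> UNIV - {{}}" "coll A m X" using error by blast
      then have "of_bool (coll A m X) \<le> (\<Sum>A\<in>UNIV - {{}}. of_bool (coll A m X) :: real)"
        by (intro member_le_sum) auto
      then show "1 \<le> (\<Sum>A\<in>UNIV - {{}}. of_bool (coll A m X) :: real)" using A by simp
    qed
    also have "\<dots> \<le> (\<Sum>m\<in>Msg. \<Sum>A\<in>UNIV - {{}}. of_bool (coll A m X))"
      using fin by (intro sum_mono2) (auto intro!: sum_nonneg)
    finally show ?thesis .
  qed
  have "(\<Sum>X\<in>Pow I. real (err X)) \<le> (\<Sum>X\<in>Pow I. \<Sum>m\<in>Msg. \<Sum>A\<in>UNIV - {{}}. of_bool (coll A m X))"
    by (intro sum_mono err_le)
  also have "\<dots> = (\<Sum>m\<in>Msg. \<Sum>A\<in>UNIV - {{}}. \<Sum>X\<in>Pow I. of_bool (coll A m X))"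
    by (subst sum.swap, subst sum.swap[of _ "UNIV - {{}}"]) (rule refl)
  also have "\<dots> \<le> (\<Sum>m\<in>Msg. \<Sum>A\<in>UNIV - {{}}. 2 ^ card I * b A)"
  proof (intro sum_mono)
    fix m and A :: "'s set" assume m: "m \<in> Msg"
    have "(\<Sum>X\<in>Pow I. of_bool (coll A m X) :: real) = card (Pow I \<inter> {X. coll A m X})"
      using fin by (intro sum_of_bool_eq) auto
    also have "Pow I \<inter> {X. coll A m X} = {X \<in> Pow I. coll A m X}" by blast
    also have "real (card \<dots>) \<le> 2 ^ card I * b A"
      unfolding coll_def I_def b_def Msg_def
      by (rule card_colliding_codebooks) (use m \<theta> in \<open>auto simp: Msg_def\<close>)
    finally show "(\<Sum>X\<in>Pow I. of_bool (coll A m X)) \<le> 2 ^ card I * b A" .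
  qed
  also have "\<dots> = (\<Sum>X\<in>Pow I. card Msg * \<beta>)"
    using fin by (simp add: \<beta>_def sum_distrib_left card_Pow mult_ac)
  finally have total: "(\<Sum>X\<in>Pow I. real (err X)) \<le> (\<Sum>X\<in>Pow I. card Msg * \<beta>)" .
  have "\<exists>X\<in>Pow I. real (err X) \<le> card Msg * \<beta>"
  proof (rule ccontr)
    assume "\<not> ?thesis"
    then have "(\<Sum>X\<in>Pow I. card Msg * \<beta>) < (\<Sum>X\<in>Pow I. real (err X))"
      using fin by (intro sum_strict_mono) (auto simp: not_le)
    with total show False by simp
  qed
  then obtain X where X: "real (err X) \<le> card Msg * \<beta>" by blast
  have Msg_pos: "0 < real (card Msg)"
    using M by (simp add: Msg_def card_message_tuples prod_pos)
  have "avg_error_prob M n (e X) (d X) = err X / card Msg"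
    by (simp add: avg_error_prob_altdef err_def Msg_def flip: card_message_tuples)
  also have "\<dots> \<le> \<beta>" using X Msg_pos by (simp add: field_simps)
  finally show ?thesis using code[of X] unfolding \<beta>_def b_def by blast
qed

text \<open>The expression is 1 at \<open>\<theta> = 0\<close> and its derivative there is
  \<open>ln 2 * (r - binomial_entropy k (1/2))\<close>, which is negative, so small positive
  exponents work.\<close>

lemma ex_renyi_exponent:
  assumes "r < binomial_entropy k (1/2)"
  shows "\<exists>\<theta>. 0 < \<theta> \<and> \<theta> \<le> 1 \<and> 2 powr (\<theta> * r) * renyi_sum k \<theta> < 1"
proof -
  define f where "f \<theta> = 2 powr (\<theta> * r) * renyi_sum k \<theta>" for \<theta>
  let ?b = "\<lambda>l. Bernstein k l (1/2)"
  have "(f has_real_derivative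
      (\<Sum>l\<le>k. r * ln 2 * ?b l + ln (?b l) * ?b l)) (at 0)"
    unfolding f_def[abs_def] renyi_sum_def
    by (auto intro!: derivative_eq_intros sum.cong simp: Bernstein_pos sum_distrib_left Bernstein_nonneg)
  also have "(\<Sum>l\<le>k. r * ln 2 * ?b l + ln (?b l) * ?b l) =
      ln 2 * (r - binomial_entropy k (1/2))"
    by (simp add: binomial_entropy_conv_nats binomial_entropy_nats_def right_diff_distrib distrib_left sum.distrib
        sum_distrib_left[symmetric] mult.commute[of "ln (Bernstein _ _ _)"])
  finally obtain \<delta> where \<delta>: "0 < \<delta>" "\<And>h. 0 < h \<Longrightarrow> h < \<delta> \<Longrightarrow> f (0 + h) < f 0"
    using DERIV_neg_dec_right[of f _ 0] mult_pos_neg[of "ln 2" "r - binomial_entropy k (1/2)"] assms by auto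
  have "f 0 = 1"
    by (simp add: f_def renyi_sum_def Bernstein_nonneg)
  \<comment> \<open>Half of \<open>\<delta>\<close> stays inside the range where \<open>f\<close> is
    below \<open>f 0\<close>, and the cap at 1 keeps the exponent admissible for the
    interpolation.\<close>
  then have "f (min (\<delta> / 2) 1) < 1" using \<delta>(1) \<delta>(2)[of "min (\<delta> / 2) 1"] by simp
  then show ?thesis using \<delta>(1) unfolding f_def by (intro exI[of _ "min (\<delta> / 2) 1"]) auto
qed

section \<open>Rates satisfying the constraints strictly, and the closure\<close>

lemma codebook_sizes_le:
  assumes "0 \<le> R $ i"
  shows "real (codebook_sizes R n i) \<le> 2 * 2 powr (real n * R $ i)"
proof -
  have "1 \<le> (2::real) powr (real n * R $ i)" using assms by (intro ge_one_powr_ge_zero) auto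
  then show ?thesis unfolding codebook_sizes_def by linarith
qed

text \<open>A separate exponent for each \<open>A\<close> makes each of the finitely many terms of
  the error bound geometric in \<open>n\<close> with ratio below 1.\<close>

lemma achievable_interior:
  fixes R :: "real ^ 's::finite"
  assumes R: "\<And>i. 0 \<le> R $ i"
    and less: "\<And>A :: 's set. A \<noteq> {} \<Longrightarrow> (\<Sum>i\<in>A. R $ i) < binomial_entropy (card A) (1/2)"
  shows "achievable R"
proof -
  \<comment> \<open>The empty set gets the default exponent 0; it is not among the error sets summed
    over.\<close>
  have "\<exists>\<theta>. 0 \<le> \<theta> \<and> \<theta> \<le> 1 \<and> (A \<noteq> {} \<longrightarrow> 2 powr (\<theta> * (\<Sum>i\<in>A. R $ i)) * renyi_sum (card A) \<theta> < 1)" for A :: "'s set"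
  proof (cases "A = {}")
    case False
    from ex_renyi_exponent[OF less[OF this]] show ?thesis by (meson less_imp_le)
  qed (auto intro: exI[of _ 0])
  then obtain \<theta> where \<theta>: "\<And>A :: 's set. 0 \<le> \<theta> A \<and> \<theta> A \<le> 1"
    and \<theta>_less: "\<And>A :: 's set. A \<noteq> {} \<Longrightarrow> 2 powr (\<theta> A * (\<Sum>i\<in>A. R $ i)) * renyi_sum (card A) (\<theta> A) < 1"
    by metis
  define \<beta> where "\<beta> n = (\<Sum>A\<in>UNIV - {{}}. (\<Prod>i\<in>A. real (codebook_sizes R n i)) powr \<theta> A *
    renyi_sum (card A) (\<theta> A) ^ n)" for n
  have "\<forall>n. \<exists>e d. is_code (codebook_sizes R n) n e d \<and> avg_error_prob (codebook_sizes R n) n e d \<le> \<beta> n"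
    unfolding \<beta>_def by (intro allI ex_code_error_le codebook_sizes_pos \<theta>)
  then obtain e d where code: "\<And>n. is_code (codebook_sizes R n) n (e n) (d n)"
    and err: "\<And>n. avg_error_prob (codebook_sizes R n) n (e n) (d n) \<le> \<beta> n"
    by metis
  let ?c = "\<lambda>A. 2 powr (\<theta> A * (\<Sum>i\<in>A. R $ i)) * renyi_sum (card A) (\<theta> A)"
  \<comment> \<open>The factor \<open>(2 ^ card A) powr \<theta> A\<close> pays for rounding the
    codebook sizes up and does not depend on \<open>n\<close>.\<close>
  let ?u = "\<lambda>n. \<Sum>A\<in>UNIV - {{}}. (2 ^ card A) powr \<theta> A * ?c A ^ n"
  have renyi_nonneg: "0 \<le> renyi_sum k t" for k t
    unfolding renyi_sum_def by (intro sum_nonneg) auto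
  have "\<beta> n \<le> ?u n" for n
    unfolding \<beta>_def
  proof (rule sum_mono)
    fix A :: "'s set"
    have "(\<Prod>i\<in>A. real (codebook_sizes R n i)) \<le> (\<Prod>i\<in>A. 2 * 2 powr (real n * R $ i))"
      by (intro prod_mono) (auto intro!: codebook_sizes_le R)
    also have "\<dots> = 2 ^ card A * 2 powr (real n * (\<Sum>i\<in>A. R $ i))"
      by (simp add: prod.distrib powr_sum sum_distrib_left)
    finally have "(\<Prod>i\<in>A. real (codebook_sizes R n i)) powr \<theta> A \<le>
        (2 ^ card A * 2 powr (real n * (\<Sum>i\<in>A. R $ i))) powr \<theta> A"
      using \<theta> by (intro powr_mono2) (auto intro!: prod_nonneg)
    also have "\<dots> = (2 ^ card A) powr \<theta> A * (2 powr (\<theta> A * (\<Sum>i\<in>A. R $ i))) ^ n"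
      by (simp add: powr_mult powr_powr powr_power mult_ac)
    finally have "(\<Prod>i\<in>A. real (codebook_sizes R n i)) powr \<theta> A * renyi_sum (card A) (\<theta> A) ^ n \<le>
        ((2 ^ card A) powr \<theta> A * (2 powr (\<theta> A * (\<Sum>i\<in>A. R $ i))) ^ n) * renyi_sum (card A) (\<theta> A) ^ n"
      by (intro mult_right_mono) (auto simp: renyi_nonneg)
    then show "(\<Prod>i\<in>A. real (codebook_sizes R n i)) powr \<theta> A * renyi_sum (card A) (\<theta> A) ^ n \<le>
        (2 ^ card A) powr \<theta> A * ?c A ^ n"
      by (simp add: power_mult_distrib mult_ac)
  qed
  then have upper: "avg_error_prob (codebook_sizes R n) n (e n) (d n) \<le> ?u n" for n
    using err[of n] order_trans by blast
  have "?u \<longlonglongrightarrow> (\<Sum>A\<in>UNIV - {{}}. (2 ^ card A) powr \<theta> A * 0)"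
    using \<theta>_less renyi_nonneg
    by (intro tendsto_sum tendsto_mult tendsto_const LIMSEQ_realpow_zero) auto
  then have u: "?u \<longlonglongrightarrow> 0" by simp
  have lower: "0 \<le> avg_error_prob (codebook_sizes R n) n (e n) (d n)" for n
    unfolding avg_error_prob_altdef by (intro divide_nonneg_nonneg of_nat_0_le_iff)
  have "(\<lambda>n. avg_error_prob (codebook_sizes R n) n (e n) (d n)) \<longlonglongrightarrow> 0"
    by (rule tendsto_sandwich[OF _ _ tendsto_const u]) (simp_all only: upper lower eventually_True)
  then show ?thesis unfolding achievable_def using R code by blast
qed

text \<open>The weight at 0 is \<open>1 / 2 ^ k\<close>, strictly between 0 and 1, so its term alone
  is positive. Positivity makes the constraints strict after scaling a rate tuple down.\<close>

lemma binomial_entropy_half_pos: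
  assumes "0 < k"
  shows "0 < binomial_entropy k (1/2)"
proof -
  let ?t = "\<lambda>l. - (Bernstein k l (1/2) * ln (Bernstein k l (1/2)))"
  have t: "0 \<le> ?t l" if "l \<le> k" for l
    using Bernstein_ln_nonpos[of "1/2" l k] that by simp
  have "0 < ?t 0"
    using assms by (simp add: Bernstein_half ln_div ln_realpow)
  also have "\<dots> \<le> (\<Sum>l\<le>k. ?t l)" using t by (intro member_le_sum) auto
  finally show ?thesis by (simp add: binomial_entropy_conv_nats binomial_entropy_nats_def sum_negf divide_less_0_iff)
qed

theorem theorem2:
  "(capacity_region :: (real ^ 's::finite) set) =
     {R. (\<forall>i. 0 \<le> R $ i) \<and>
         (\<forall>A :: 's set. (\<Sum>i\<in>A. R $ i) \<le> binomial_entropy (card A) (1 / 2))}"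
  (is "_ = ?K")
proof (intro equalityI subsetI)
  \<comment> \<open>Each constraint is a closed condition, so the bounds for achievable tuples pass
    to the closure.\<close>
  have "?K = (\<Inter>i. {R. 0 \<le> R $ i}) \<inter> (\<Inter>A. {R. (\<Sum>i\<in>A. R $ i) \<le> binomial_entropy (card A) (1 / 2)})"
    by auto
  also have "closed \<dots>"
    by (intro closed_Int closed_INT ballI closed_Collect_le continuous_intros)
  finally have "closed ?K" .
  moreover have "{R. achievable R} \<subseteq> ?K"
    using achievable_imp_sum_le by (auto simp: achievable_def)
  ultimately have "capacity_region \<subseteq> ?K" unfolding capacity_region_def by (intro closure_minimal)
  then show "R \<in> ?K" if "R \<in> capacity_region" for R using that by blast
next
  fix R :: "real ^ 's" assume R: "R \<in> ?K"
  \<comment> \<open>Scaling by \<open>c n < 1\<close> makes the constraints strict for nonempty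
    \<open>A\<close>, and \<open>c n\<close> tends to 1; the offset 2 starts the sequence at
    \<open>1/2\<close>.\<close>
  define c where "c n = 1 - 1 / real (n + 2)" for n
  have c: "0 \<le> c n" "c n < 1" for n by (auto simp: c_def field_simps)
  have "achievable (c n *\<^sub>R R)" for n
  proof (rule achievable_interior)
    show "0 \<le> (c n *\<^sub>R R) $ i" for i using R c by simp
    fix A :: "'s set" assume A: "A \<noteq> {}"
    let ?h = "binomial_entropy (card A) (1/2)"
    have "0 < ?h" using A by (intro binomial_entropy_half_pos) (simp add: card_gt_0_iff)
    have "(\<Sum>i\<in>A. (c n *\<^sub>R R) $ i) = c n * (\<Sum>i\<in>A. R $ i)" by (simp add: sum_distrib_left)
    also have "\<dots> \<le> c n * ?h" using R c by (intro mult_left_mono) auto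
    also have "\<dots> < 1 * ?h" using c \<open>0 < ?h\<close> by (intro mult_strict_right_mono) auto
    finally show "(\<Sum>i\<in>A. (c n *\<^sub>R R) $ i) < ?h" by simp
  qed
  moreover have "c \<longlonglongrightarrow> 1 - 0"
    unfolding c_def using LIMSEQ_ignore_initial_segment[OF lim_1_over_n, of 2]
    by (intro tendsto_diff tendsto_const) simp
  then have "(\<lambda>n. c n *\<^sub>R R) \<longlonglongrightarrow> 1 *\<^sub>R R" by (intro tendsto_intros) simp
  then have "(\<lambda>n. c n *\<^sub>R R) \<longlonglongrightarrow> R" by simp
  ultimately show "R \<in> capacity_region"
    unfolding capacity_region_def closure_sequential by (intro exI[of _ "\<lambda>n. c n *\<^sub>R R"]) auto
qed

end
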